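(* Let $L_1,\ldots,L_n$ be finite lower locally distributive lattices, $N=\{1,\ldots,n\}$, $L=L_1\times\cdots\times L_n$ with the product order, $v:L\to\mathbb{R}$, and $m$ the Möbius transform of $v$ on $L$ (i.e. $v(x)=\sum_{y\leq x}m(y)$ for all $x\in L$). Let $K\subseteq N$, assume $L_k$ is distributive for every $k\in K$, and let $x\in\tilde{L}_K$. Let $(\alpha^{|K|}_h)_h$ be real constants and let \[I(x):=\sum_{y}\alpha^{|K|}_{h(y)}\,\Delta_x v(y),\] the sum being over all $y\in L$ with $y_k\in\{\top_k,\bot_k\}$ for $k\notin K$ and $y_k=\underline{i_k}$ for $k\in K$. Then \[I(x)=\sum_{z\in[x,\check{x}]}\beta^{|K|}_{k(z)}\,m(z),\] where $\check{x}\in L$ is defined by $\check{x}_k=\top_k$ for $k\notin K$ and $\check{x}_k=x_k$ for $k\in K$, $k(z)$ is the number of coordinates $l$ of $z$ with $z_l\neq\bot_l$, and \[\beta^{|K|}_{k(z)}=\sum_{l=0}^{n-k(z)}\binom{n-k(z)}{l}\alpha^{|K|}_{k(z)-|K|+l}.\]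
   Context: $\top_k,\bot_k$ denote top and bottom of $L_k$. A finite lattice is lower locally distributive if it is lower semi-modular and contains no sublattice isomorphic to $M_3$. Join-irreducible elements are non-bottom elements covering exactly one element. In such a lattice every $z$ has a unique minimal decomposition $z=\bigvee\eta^*(z)$ into join-irreducible elements of minimal cardinality. Join-irreducible elements of $L$ are the elements with one coordinate $j$ equal to a join-irreducible element of $L_j$ and all other coordinates bottom. For $K\subseteq N$, $\tilde{L}_K:=\{x\in L\mid \forall k\in K\ \exists!\ \underline{i_k}\in L_k$ such that every $i\in\eta^*(x_k)$ covers $\underline{i_k}$, and $x_k=\bot_k$ for $k\notin K\}$; for $x\in\tilde L_K$ and $k\in K$, $\underline{i_k}$ denotes this element. For join-irreducible $i$ of $L$, $\Delta_i v(y):=v(y\vee i)-v(y)$; if $\eta^*(x)=\{i_1,\ldots,i_p\}$ in $L$, $\Delta_x v(y):=\Delta_{i_1}(\Delta_{i_2}(\cdots\Delta_{i_p}v(y)\cdots))$. $h(y)$ is the number of coordinates $l$ of $y$ with $y_l=\top_l$.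
   Formalization: Every factor L_k is assumed to have at least two elements (bottom ≠ top); with a one-element factor the formula fails, e.g. n=1, K empty, L_1 a point gives α_1 v(⊥) on the left but (α_0+α_1) v(⊥) on the right. *)

theory Defs
  imports Complex_Main "HOL-Algebra.Lattice" "HOL-Library.FuncSet"
begin

definition finite_lattice :: "('a, 'b) gorder_scheme \<Rightarrow> bool" where
  "finite_lattice L \<longleftrightarrow> bounded_lattice L \<and> finite (carrier L)"

definition distributive_lattice :: "('a, 'b) gorder_scheme \<Rightarrow> bool" where
  "distributive_lattice L \<longleftrightarrow> lattice L \<and>
     (\<forall>x\<in>carrier L. \<forall>y\<in>carrier L. \<forall>z\<in>carrier L.
        x \<sqinter>\<^bsub>L\<^esub> (y \<squnion>\<^bsub>L\<^esub> z) = (x \<sqinter>\<^bsub>L\<^esub> y) \<squnion>\<^bsub>L\<^esub> (x \<sqinter>\<^bsub>L\<^esub> z))"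

text \<open>\<open>covers L x y\<close> reads ``\<open>x\<close> covers \<open>y\<close>'', i.e. \<open>y\<close> is the smaller element.\<close>

definition covers :: "('a, 'b) gorder_scheme \<Rightarrow> 'a \<Rightarrow> 'a \<Rightarrow> bool" where
  "covers L x y \<longleftrightarrow> x \<in> carrier L \<and> y \<in> carrier L \<and> y \<sqsubset>\<^bsub>L\<^esub> x \<and>
     \<not> (\<exists>z\<in>carrier L. y \<sqsubset>\<^bsub>L\<^esub> z \<and> z \<sqsubset>\<^bsub>L\<^esub> x)"

definition lower_semimodular :: "('a, 'b) gorder_scheme \<Rightarrow> bool" where
  "lower_semimodular L \<longleftrightarrow> lattice L \<and>
     (\<forall>x\<in>carrier L. \<forall>y\<in>carrier L.
        covers L (x \<squnion>\<^bsub>L\<^esub> y) x \<and> covers L (x \<squnion>\<^bsub>L\<^esub> y) y \<longrightarrow>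
        covers L x (x \<sqinter>\<^bsub>L\<^esub> y) \<and> covers L y (x \<sqinter>\<^bsub>L\<^esub> y))"

definition sublattice :: "('a, 'b) gorder_scheme \<Rightarrow> 'a set \<Rightarrow> bool" where
  "sublattice L S \<longleftrightarrow> S \<subseteq> carrier L \<and> S \<noteq> {} \<and>
     (\<forall>x\<in>S. \<forall>y\<in>S. x \<squnion>\<^bsub>L\<^esub> y \<in> S \<and> x \<sqinter>\<^bsub>L\<^esub> y \<in> S)"

text \<open>The diamond: bottom \<open>0\<close>, top \<open>4\<close>, and three pairwise incomparable elements
  \<open>1, 2, 3\<close> in between.\<close>

definition M3 :: "nat gorder" where
  "M3 = \<lparr>carrier = {0..4}, eq = (=), le = (\<lambda>x y. x = y \<or> x = 0 \<or> y = 4)\<rparr>"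

definition has_M3_sublattice :: "('a, 'b) gorder_scheme \<Rightarrow> bool" where
  "has_M3_sublattice L \<longleftrightarrow> (\<exists>S f. sublattice L S \<and>
     order_emb M3 (L\<lparr>carrier := S\<rparr>) f \<and> bij_betw f (carrier M3) S)"

definition lower_locally_distributive :: "('a, 'b) gorder_scheme \<Rightarrow> bool" where
  "lower_locally_distributive L \<longleftrightarrow>
     finite_lattice L \<and> lower_semimodular L \<and> \<not> has_M3_sublattice L"

definition join_irreducibles :: "('a, 'b) gorder_scheme \<Rightarrow> 'a set" where
  "join_irreducibles L = {i \<in> carrier L. i \<noteq> \<bottom>\<^bsub>L\<^esub> \<and> (\<exists>!j. covers L i j)}"

definition min_decomposition :: "('a, 'b) gorder_scheme \<Rightarrow> 'a \<Rightarrow> 'a set" (\<open>\<eta>\<^sup>*\<index>\<close>) where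
  "\<eta>\<^sup>*\<^bsub>L\<^esub> z = (THE S. S \<subseteq> join_irreducibles L \<and> \<Squnion>\<^bsub>L\<^esub>S = z \<and>
     (\<forall>T \<subseteq> join_irreducibles L. \<Squnion>\<^bsub>L\<^esub>T = z \<longrightarrow> card S \<le> card T))"

text \<open>The product \<open>L\<^sub>1 \<times> \<dots> \<times> L\<^sub>n\<close> with the componentwise order. Its elements are functions
  on \<open>{1..n}\<close>, extended by \<^term>\<open>undefined\<close>.\<close>

definition product_order :: "nat \<Rightarrow> (nat \<Rightarrow> 'a gorder) \<Rightarrow> (nat \<Rightarrow> 'a) gorder" where
  "product_order n L = \<lparr>carrier = (\<Pi>\<^sub>E k\<in>{1..n}. carrier (L k)), eq = (=),
     le = (\<lambda>x y. \<forall>k\<in>{1..n}. x k \<sqsubseteq>\<^bsub>L k\<^esub> y k)\<rparr>"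

definition moebius_transform ::
    "('a, 'b) gorder_scheme \<Rightarrow> ('a \<Rightarrow> real) \<Rightarrow> ('a \<Rightarrow> real) \<Rightarrow> bool" where
  "moebius_transform L v m \<longleftrightarrow>
     (\<forall>x\<in>carrier L. v x = (\<Sum>y\<in>{y \<in> carrier L. y \<sqsubseteq>\<^bsub>L\<^esub> x}. m y))"

text \<open>The derivative is restricted to the carrier, so that \<open>deriv1 L i\<close> and \<open>deriv1 L j\<close>
  commute as operators on all functions and the fold below does not depend on the order in
  which the elements of the minimal decomposition are enumerated.\<close>

definition deriv1 :: "('a, 'b) gorder_scheme \<Rightarrow> 'a \<Rightarrow> ('a \<Rightarrow> real) \<Rightarrow> 'a \<Rightarrow> real" where
  "deriv1 L i v = (\<lambda>y\<in>carrier L. v (y \<squnion>\<^bsub>L\<^esub> i) - v y)"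

definition lattice_deriv :: "('a, 'b) gorder_scheme \<Rightarrow> 'a \<Rightarrow> ('a \<Rightarrow> real) \<Rightarrow> 'a \<Rightarrow> real" where
  "lattice_deriv L x v = Finite_Set.fold (deriv1 L) v (\<eta>\<^sup>*\<^bsub>L\<^esub> x)"

lemma deriv1_commute:
  assumes "lattice L"
  shows "comp_fun_commute_on (carrier L) (deriv1 L)"
proof -
  interpret lattice L by fact
  show ?thesis
  proof
    fix i j assume ij: "i \<in> carrier L" "j \<in> carrier L"
    show "deriv1 L j \<circ> deriv1 L i = deriv1 L i \<circ> deriv1 L j"
    proof (intro ext)
      fix v y
      have "(y \<squnion>\<^bsub>L\<^esub> j) \<squnion>\<^bsub>L\<^esub> i = (y \<squnion>\<^bsub>L\<^esub> i) \<squnion>\<^bsub>L\<^esub> j" if "y \<in> carrier L"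
        using ij that by (metis eq_is_equal join_comm weak_join_assoc)
      then show "(deriv1 L j \<circ> deriv1 L i) v y = (deriv1 L i \<circ> deriv1 L j) v y"
        using ij by (auto simp: deriv1_def)
    qed
  qed
qed

lemma lattice_deriv_eq_foldr:
  assumes "lattice L" "set is = \<eta>\<^sup>*\<^bsub>L\<^esub> x" "distinct is" "set is \<subseteq> carrier L"
  shows "lattice_deriv L x v = foldr (deriv1 L) is v"
proof -
  interpret comp_fun_commute_on "carrier L" "deriv1 L"
    by (rule deriv1_commute) fact
  have "Finite_Set.fold (deriv1 L) v (set js) = foldr (deriv1 L) js v"
    if "distinct js" "set js \<subseteq> carrier L" for js
    using that by (induction js) auto
  then show ?thesis
    using assms by (metis lattice_deriv_def)
qed

definition is_common_lower_cover :: "('a, 'b) gorder_scheme \<Rightarrow> 'a \<Rightarrow> 'a \<Rightarrow> bool" where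
  "is_common_lower_cover L a j \<longleftrightarrow> j \<in> carrier L \<and> (\<forall>i\<in>\<eta>\<^sup>*\<^bsub>L\<^esub> a. covers L i j)"

definition common_lower_cover :: "('a, 'b) gorder_scheme \<Rightarrow> 'a \<Rightarrow> 'a" where
  "common_lower_cover L a = (THE j. is_common_lower_cover L a j)"

definition L_tilde :: "nat \<Rightarrow> (nat \<Rightarrow> 'a gorder) \<Rightarrow> nat set \<Rightarrow> (nat \<Rightarrow> 'a) set" where
  "L_tilde n L K = {x \<in> carrier (product_order n L).
     (\<forall>k\<in>K. \<exists>!j. is_common_lower_cover (L k) (x k) j) \<and>
     (\<forall>k\<in>{1..n} - K. x k = \<bottom>\<^bsub>L k\<^esub>)}"

definition num_top :: "nat \<Rightarrow> (nat \<Rightarrow> 'a gorder) \<Rightarrow> (nat \<Rightarrow> 'a) \<Rightarrow> nat" where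
  "num_top n L y = card {l \<in> {1..n}. y l = \<top>\<^bsub>L l\<^esub>}"

definition num_nonbot :: "nat \<Rightarrow> (nat \<Rightarrow> 'a gorder) \<Rightarrow> (nat \<Rightarrow> 'a) \<Rightarrow> nat" where
  "num_nonbot n L z = card {l \<in> {1..n}. z l \<noteq> \<bottom>\<^bsub>L l\<^esub>}"

text \<open>Here and in \<open>beta\<close>, the first argument of \<open>\<alpha>\<close> is the superscript \<open>|K|\<close>.\<close>

definition interaction :: "nat \<Rightarrow> (nat \<Rightarrow> 'a gorder) \<Rightarrow> nat set \<Rightarrow> (nat \<Rightarrow> nat \<Rightarrow> real) \<Rightarrow>
    ((nat \<Rightarrow> 'a) \<Rightarrow> real) \<Rightarrow> (nat \<Rightarrow> 'a) \<Rightarrow> real" where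
  "interaction n L K \<alpha> v x =
     (\<Sum>y\<in>{y \<in> carrier (product_order n L).
            (\<forall>k\<in>{1..n} - K. y k \<in> {\<top>\<^bsub>L k\<^esub>, \<bottom>\<^bsub>L k\<^esub>}) \<and>
            (\<forall>k\<in>K. y k = common_lower_cover (L k) (x k))}.
        \<alpha> (card K) (num_top n L y) * lattice_deriv (product_order n L) x v y)"

definition x_check :: "nat \<Rightarrow> (nat \<Rightarrow> 'a gorder) \<Rightarrow> nat set \<Rightarrow> (nat \<Rightarrow> 'a) \<Rightarrow> nat \<Rightarrow> 'a" where
  "x_check n L K x = (\<lambda>k\<in>{1..n}. if k \<in> K then x k else \<top>\<^bsub>L k\<^esub>)"

text \<open>The truncated subtraction \<open>k - c\<close> is harmless: for \<open>x \<in> L_tilde n L K\<close> and \<open>z\<close> above \<open>x\<close>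
  all coordinates of \<open>z\<close> in \<open>K\<close> are non-bottom (the \<open>L k\<close> being non-trivial), so
  \<open>num_nonbot n L z \<ge> card K\<close>.\<close>

definition beta :: "nat \<Rightarrow> (nat \<Rightarrow> nat \<Rightarrow> real) \<Rightarrow> nat \<Rightarrow> nat \<Rightarrow> real" where
  "beta n \<alpha> c k = (\<Sum>l=0..n - k. real ((n - k) choose l) * \<alpha> c (k - c + l))"

end

theory Submission
  imports Defs
begin

text \<open>
  In a distributive coordinate every join-irreducible element \<open>i\<close> is join-prime, and if its lower
  cover lies below \<open>y\<close>, then \<open>z \<le> y \<squnion> i\<close> forces \<open>i \<le> z\<close> or \<open>z \<le> y\<close>. Hence differencing
  \<open>\<Sum>\<^sub>z\<^sub>\<le>\<^sub>y m z\<close> in direction \<open>i\<close> just adds the constraint \<open>i \<le> z\<close>, and iterating over the minimal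
  decomposition of \<open>x\<close> shows that \<open>\<Delta>\<^sub>x v y\<close> is the sum of \<open>m\<close> over \<open>[x, y \<squnion> x]\<close>. Exchanging the two
  sums, the coefficient of \<open>m z\<close> collects the \<open>\<alpha>\<close>-weights of all \<open>y\<close> that have a top wherever
  \<open>z\<close> is non-bottom outside \<open>K\<close>; counting these by their number of tops gives the binomial sum.
\<close>

text \<open>Excluding the bottom is the case of the empty join: with it, primality for two elements
  passes to joins of arbitrary subsets in \<open>join_prime_Sup\<close>.\<close>

definition join_prime :: "('a, 'b) gorder_scheme \<Rightarrow> 'a \<Rightarrow> bool" where
  "join_prime L i \<longleftrightarrow> i \<in> carrier L \<and> i \<noteq> \<bottom>\<^bsub>L\<^esub> \<and>
     (\<forall>a\<in>carrier L. \<forall>b\<in>carrier L. i \<sqsubseteq>\<^bsub>L\<^esub> a \<squnion>\<^bsub>L\<^esub> b \<longrightarrow> i \<sqsubseteq>\<^bsub>L\<^esub> a \<or> i \<sqsubseteq>\<^bsub>L\<^esub> b)"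

text \<open>Removing the forced part \<open>B\<close> leaves an arbitrary subset of
  \<open>C\<close>, and grouping these subsets by size produces the binomial coefficients. This is
  where the shape of \<open>beta\<close> comes from.\<close>

lemma sum_card_subsets_between:
  assumes "finite B" "finite C" "B \<inter> C = {}"
  shows "(\<Sum>A\<in>{A. B \<subseteq> A \<and> A \<subseteq> B \<union> C}. f (card A)) =
    (\<Sum>l=0..card C. real (card C choose l) * (f (card B + l) :: real))"
proof -
  have bij: "bij_betw (\<lambda>S. B \<union> S) (Pow C) {A. B \<subseteq> A \<and> A \<subseteq> B \<union> C}"
    by (rule bij_betwI[where g = "\<lambda>A. A - B"]) (use assms in auto)
  have "(\<Sum>A\<in>{A. B \<subseteq> A \<and> A \<subseteq> B \<union> C}. f (card A)) = (\<Sum>S\<in>Pow C. f (card (B \<union> S)))"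
    by (rule sum.reindex_bij_betw[OF bij, symmetric])
  also have "\<dots> = (\<Sum>S\<in>Pow C. f (card B + card S))"
  proof (rule sum.cong[OF refl])
    fix S assume "S \<in> Pow C"
    then have "card (B \<union> S) = card B + card S"
      using assms by (intro card_Un_disjoint) (auto intro: finite_subset)
    then show "f (card (B \<union> S)) = f (card B + card S)"
      by simp
  qed
  also have "\<dots> = (\<Sum>l\<in>{0..card C}. \<Sum>S\<in>{S \<in> Pow C. card S = l}. f (card B + card S))"
    using assms by (intro sum.group[symmetric]) (auto intro: card_mono)
  also have "\<dots> = (\<Sum>l=0..card C. real (card C choose l) * f (card B + l))"
    using n_subsets[OF assms(2)] by (intro sum.cong[OF refl]) (simp add: Pow_def)
  finally show ?thesis .
qed

section \<open>Join-irreducible elements of finite lattices\<close>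

locale fin_lattice = bounded_lattice +
  assumes finite_carrier: "finite (carrier L)"
begin

section \<open>Joins of arbitrary subsets of a finite lattice\<close>

lemma Sup_least_Upper:
  assumes "S \<subseteq> carrier L"
  shows "least L (\<Squnion>S) (Upper L S)"
proof (cases "S = {}")
  case True
  \<comment> \<open>Every element is an upper bound of the empty set, so a least element of the
    carrier is the required least upper bound.\<close>
  then show ?thesis
    using someI_ex[OF bottom_exists] by (simp add: sup_def)
next
  case False
  then show ?thesis
    using assms finite_carrier finite_subset by (blast intro: finite_sup_least)
qed

lemma Sup_closed: "S \<subseteq> carrier L \<Longrightarrow> \<Squnion>S \<in> carrier L"
  by (rule least_closed[OF Sup_least_Upper])

lemma Sup_upper: "S \<subseteq> carrier L \<Longrightarrow> s \<in> S \<Longrightarrow> s \<sqsubseteq> \<Squnion>S"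
  by (rule least_Upper_above[OF Sup_least_Upper])

lemma Sup_le: "S \<subseteq> carrier L \<Longrightarrow> u \<in> carrier L \<Longrightarrow> (\<And>s. s \<in> S \<Longrightarrow> s \<sqsubseteq> u) \<Longrightarrow> \<Squnion>S \<sqsubseteq> u"
  by (rule least_le[OF Sup_least_Upper]) (auto intro: Upper_memI)

lemma Sup_eqI:
  assumes "S \<subseteq> carrier L" "z \<in> carrier L" "\<And>s. s \<in> S \<Longrightarrow> s \<sqsubseteq> z"
    "\<And>u. u \<in> carrier L \<Longrightarrow> (\<And>s. s \<in> S \<Longrightarrow> s \<sqsubseteq> u) \<Longrightarrow> z \<sqsubseteq> u"
  shows "\<Squnion>S = z"
proof (rule le_antisym)
  show "\<Squnion>S \<sqsubseteq> z"
    using assms by (intro Sup_le) auto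
  show "z \<sqsubseteq> \<Squnion>S"
    using assms(1) by (intro assms(4) Sup_closed Sup_upper) auto
qed (use assms(1,2) Sup_closed[of S] in auto)

lemma Sup_empty: "\<Squnion>{} = \<bottom>"
  by (rule Sup_eqI) auto

lemma Sup_insert:
  assumes "a \<in> carrier L" "S \<subseteq> carrier L"
  shows "\<Squnion>(insert a S) = a \<squnion> \<Squnion>S"
proof (rule Sup_eqI)
  note S = Sup_closed[OF assms(2)]
  show "s \<sqsubseteq> a \<squnion> \<Squnion>S" if "s \<in> insert a S" for s
    using that assms S join_left[of a "\<Squnion>S"] join_right[of a "\<Squnion>S"] Sup_upper[of S s]
      le_trans[of s "\<Squnion>S" "a \<squnion> \<Squnion>S"] by auto
  show "a \<squnion> \<Squnion>S \<sqsubseteq> u" if "u \<in> carrier L" "\<And>s. s \<in> insert a S \<Longrightarrow> s \<sqsubseteq> u" for u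
    using that assms S by (intro join_le Sup_le) auto
qed (use assms Sup_closed[of S] in auto)

lemma join_prime_Sup:
  assumes "join_prime L i" "S \<subseteq> carrier L" "i \<sqsubseteq> \<Squnion>S"
  shows "\<exists>s\<in>S. i \<sqsubseteq> s"
proof -
  have "finite S"
    using assms(2) finite_carrier by (rule finite_subset)
  then show ?thesis
    using assms(2,3)
  proof (induction S rule: finite_induct)
    case empty
    then have "i = \<bottom>"
      using assms(1) by (auto simp: join_prime_def Sup_empty intro: le_antisym)
    then show ?case
      using assms(1) by (simp add: join_prime_def)
  next
    case (insert a S)
    then have "i \<sqsubseteq> a \<or> i \<sqsubseteq> \<Squnion>S"
      using assms(1) Sup_closed[of S] by (simp add: join_prime_def Sup_insert)
    then show ?case
      using insert by auto
  qed
qed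

section \<open>Lower covers and join-irreducible elements\<close>

lemma lower_cover_above:
  assumes "a \<in> carrier L" "b \<in> carrier L" "a \<sqsubset> b"
  shows "\<exists>c. covers L b c \<and> a \<sqsubseteq> c"
proof -
  \<comment> \<open>An element that maximizes the number of elements below it, among those above
    \<open>a\<close> and strictly below \<open>b\<close>, is maximal there and hence a lower cover
    of \<open>b\<close>.\<close>
  define down where "down c = {d \<in> carrier L. d \<sqsubseteq> c}" for c
  have fin: "finite (down c)" for c
    using finite_carrier by (simp add: down_def)
  let ?P = "\<lambda>c. c \<in> carrier L \<and> a \<sqsubseteq> c \<and> c \<sqsubset> b"
  have "\<exists>c. ?P c \<and> (\<forall>d. ?P d \<longrightarrow> card (down d) \<le> card (down c))"
  proof (rule ex_has_greatest_nat)
    show "?P a"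
      using assms by auto
    show "\<forall>d. ?P d \<longrightarrow> card (down d) < Suc (card (carrier L))"
      using finite_carrier by (auto simp: down_def less_Suc_eq_le intro!: card_mono)
  qed
  then obtain c where c: "?P c" and max: "\<And>d. ?P d \<Longrightarrow> card (down d) \<le> card (down c)"
    by blast
  have False if d: "d \<in> carrier L" "c \<sqsubset> d" "d \<sqsubset> b" for d
  proof -
    have cd: "c \<sqsubseteq> d" "c \<noteq> d"
      using d by (auto simp: lless_eq)
    have "down c \<subseteq> down d"
      using c cd d by (auto simp: down_def intro: le_trans)
    moreover have "d \<in> down d - down c"
      using c cd d le_antisym by (auto simp: down_def)
    ultimately have "card (down c) < card (down d)"
      using fin by (intro psubset_card_mono) auto
    moreover have "a \<sqsubseteq> d"
      using assms c cd d by (blast intro: le_trans)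
    ultimately show False
      using max[of d] d by simp
  qed
  then show ?thesis
    using c assms by (auto simp: covers_def)
qed

text \<open>If the lower cover is unique, two elements strictly below \<open>i\<close> both lie
  under it, and so does their join; conversely, two distinct lower covers would join to
  \<open>i\<close>. The form with joins is the one that can be compared between the product and its
  coordinates.\<close>

lemma join_irreducible_iff:
  "i \<in> join_irreducibles L \<longleftrightarrow> i \<in> carrier L \<and> i \<noteq> \<bottom> \<and>
     (\<forall>a\<in>carrier L. \<forall>b\<in>carrier L. a \<squnion> b = i \<longrightarrow> a = i \<or> b = i)"
  (is "?l \<longleftrightarrow> ?r")
proof
  assume l: ?l
  then obtain j where i: "i \<in> carrier L" "i \<noteq> \<bottom>" and j: "covers L i j"
    and uniq: "\<And>j'. covers L i j' \<Longrightarrow> j' = j"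
    by (auto simp: join_irreducibles_def)
  have "a = i \<or> b = i" if ab: "a \<in> carrier L" "b \<in> carrier L" "a \<squnion> b = i" for a b
  proof (rule ccontr)
    assume "\<not> (a = i \<or> b = i)"
    then have "a \<sqsubset> i" "b \<sqsubset> i"
      using ab by (auto simp: lless_eq intro: join_left join_right)
    then have "a \<sqsubseteq> j" "b \<sqsubseteq> j"
      using lower_cover_above ab i uniq by blast+
    then have "i \<sqsubseteq> j"
      using ab j by (auto simp: covers_def intro: join_le)
    then show False
      using j by (auto simp: covers_def lless_eq intro: le_antisym)
  qed
  then show ?r
    using i by blast
next
  assume r: ?r
  then have "\<bottom> \<sqsubset> i"
    by (auto simp: lless_eq)
  then obtain j where j: "covers L i j"
    using lower_cover_above[of \<bottom> i] r by auto
  have "j' = j" if j': "covers L i j'" for j'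
  proof (rule ccontr)
    assume ne: "j' \<noteq> j"
    have c: "j \<in> carrier L" "j' \<in> carrier L" "j \<sqsubset> i" "j' \<sqsubset> i"
      using j j' by (auto simp: covers_def)
    have "j \<squnion> j' \<sqsubseteq> i"
      using c r by (auto simp: lless_eq intro: join_le)
    moreover have "j \<squnion> j' \<noteq> i"
      using c r by (auto simp: lless_eq)
    ultimately have "j \<squnion> j' \<sqsubset> i"
      by (simp add: lless_eq)
    then have "\<not> j \<sqsubset> j \<squnion> j'" "\<not> j' \<sqsubset> j \<squnion> j'"
      using j j' c by (auto simp: covers_def)
    then show False
      using c ne join_left[of j j'] join_right[of j j'] by (auto simp: lless_eq)
  qed
  then show ?l
    using r j by (auto simp: join_irreducibles_def)
qed

section \<open>Decompositions into join-irreducible elements\<close>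

lemma join_irreducibles_closed: "join_irreducibles L \<subseteq> carrier L"
  by (auto simp: join_irreducibles_def)

text \<open>Induction on the number of elements below \<open>x\<close>: if \<open>x\<close> is
  neither the bottom nor join-irreducible, it is the join of two strictly smaller elements, to which
  the induction hypothesis applies. This provides at least one decomposition of
  \<open>x\<close>.\<close>

lemma Sup_join_irreducibles_below:
  assumes "x \<in> carrier L"
  shows "\<Squnion>{i \<in> join_irreducibles L. i \<sqsubseteq> x} = x"
  using assms
proof (induction "card {d \<in> carrier L. d \<sqsubseteq> x}" arbitrary: x rule: less_induct)
  case less
  let ?J = "\<lambda>x. {i \<in> join_irreducibles L. i \<sqsubseteq> x}"
  have J: "?J y \<subseteq> carrier L" for y
    using join_irreducibles_closed by blast
  \<comment> \<open>An upper bound of the join-irreducibles under \<open>x\<close> also bounds those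
    under a smaller \<open>a\<close>, hence bounds \<open>a\<close> itself by the induction
    hypothesis.\<close>
  have below: "a \<sqsubseteq> u" if a: "a \<in> carrier L" "a \<sqsubseteq> x" "a \<noteq> x" and u: "u \<in> carrier L"
    "\<And>i. i \<in> ?J x \<Longrightarrow> i \<sqsubseteq> u" for a u
  proof -
    have "{d \<in> carrier L. d \<sqsubseteq> a} \<subset> {d \<in> carrier L. d \<sqsubseteq> x}"
      using a less.prems by (auto intro: le_trans dest: le_antisym)
    then have "\<Squnion>(?J a) = a"
      using a finite_carrier by (intro less.hyps psubset_card_mono) auto
    moreover have "i \<sqsubseteq> u" if "i \<in> ?J a" for i
      using that a less.prems join_irreducibles_closed by (intro u) (auto intro: le_trans)
    then have "\<Squnion>(?J a) \<sqsubseteq> u"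
      by (rule Sup_le[OF J u(1)])
    ultimately show ?thesis
      by simp
  qed
  show ?case
  proof (rule Sup_eqI[OF J less.prems])
    fix u assume u: "u \<in> carrier L" "\<And>i. i \<in> ?J x \<Longrightarrow> i \<sqsubseteq> u"
    show "x \<sqsubseteq> u"
    proof (cases "x \<in> join_irreducibles L \<or> x = \<bottom>")
      case True
      then show ?thesis
        using u less.prems by auto
    next
      case False
      then obtain a b where ab: "a \<in> carrier L" "b \<in> carrier L" "a \<squnion> b = x" "a \<noteq> x" "b \<noteq> x"
        using less.prems by (auto simp: join_irreducible_iff)
      then have "a \<sqsubseteq> u" "b \<sqsubseteq> u"
        using below[of a u] below[of b u] u join_left join_right by metis+
      then show ?thesis
        using ab u join_le by metis
    qed
  qed auto
qed

text \<open>Let \<open>T\<close> be any decomposition of \<open>x\<close>. By primality each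
  \<open>i\<close> in \<open>M\<close> lies under some \<open>t\<close> in \<open>T\<close>, which
  in turn lies under some \<open>i'\<close> in \<open>M\<close>; since \<open>M\<close> is an
  antichain, \<open>i = t = i'\<close>. So \<open>M\<close> is contained in every decomposition and
  is the only one of least cardinality. Primality is asked only below \<open>x\<close> because the
  product may be non-distributive in coordinates where \<open>x\<close> is the bottom.\<close>

lemma min_decomposition_eqI:
  assumes M: "M \<subseteq> join_irreducibles L" "\<Squnion>M = x"
    and antichain: "\<And>i j. i \<in> M \<Longrightarrow> j \<in> M \<Longrightarrow> i \<sqsubseteq> j \<Longrightarrow> i = j"
    and prime: "\<And>i. i \<in> join_irreducibles L \<Longrightarrow> i \<sqsubseteq> x \<Longrightarrow> join_prime L i"
  shows "\<eta>\<^sup>*\<^bsub>L\<^esub> x = M"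
proof -
  have Mc: "M \<subseteq> carrier L"
    using M join_irreducibles_closed by blast
  have sub: "M \<subseteq> T" if T: "T \<subseteq> join_irreducibles L" "\<Squnion>T = x" for T
  proof
    fix i assume i: "i \<in> M"
    have Tc: "T \<subseteq> carrier L"
      using T join_irreducibles_closed by blast
    have ix: "i \<sqsubseteq> x"
      using i M Mc Sup_upper by blast
    then obtain t where t: "t \<in> T" "i \<sqsubseteq> t"
      using join_prime_Sup[of i T] prime[of i] i M(1) T Tc by auto
    have "t \<sqsubseteq> x"
      using t T Tc Sup_upper by blast
    then obtain i' where i': "i' \<in> M" "t \<sqsubseteq> i'"
      using join_prime_Sup[of t M] prime[of t] t M T(1) Mc by auto
    then have "i = i'"
      using antichain[of i i'] i t Mc Tc by (meson le_trans subsetD)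
    then have "i = t"
      using i i' t Mc Tc le_antisym by blast
    then show "i \<in> T"
      using t by simp
  qed
  have fin: "finite T" if "T \<subseteq> join_irreducibles L" for T
    using that join_irreducibles_closed finite_carrier by (meson finite_subset)
  show ?thesis
    unfolding min_decomposition_def
  proof (rule the_equality)
    show "M \<subseteq> join_irreducibles L \<and> \<Squnion>M = x \<and>
      (\<forall>T\<subseteq>join_irreducibles L. \<Squnion>T = x \<longrightarrow> card M \<le> card T)"
      using M card_mono[OF fin sub] by blast
  next
    fix S assume S: "S \<subseteq> join_irreducibles L \<and> \<Squnion>S = x \<and>
      (\<forall>T\<subseteq>join_irreducibles L. \<Squnion>T = x \<longrightarrow> card S \<le> card T)"
    then show "S = M"
      using sub[of S] fin[of S] M card_seteq[of S M] by blast
  qed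
qed

text \<open>A decomposition of least cardinality is an antichain: an element under another one could
  be dropped without changing the join. Then \<open>min_decomposition_eqI\<close> identifies it with
  the value of the definite description.\<close>

lemma min_decomposition_antichain:
  assumes x: "x \<in> carrier L"
    and prime: "\<And>i. i \<in> join_irreducibles L \<Longrightarrow> i \<sqsubseteq> x \<Longrightarrow> join_prime L i"
  shows "\<eta>\<^sup>*\<^bsub>L\<^esub> x \<subseteq> join_irreducibles L" "\<Squnion>(\<eta>\<^sup>*\<^bsub>L\<^esub> x) = x"
    "\<And>i j. i \<in> \<eta>\<^sup>*\<^bsub>L\<^esub> x \<Longrightarrow> j \<in> \<eta>\<^sup>*\<^bsub>L\<^esub> x \<Longrightarrow> i \<sqsubseteq> j \<Longrightarrow> i = j"
proof -
  let ?P = "\<lambda>M. M \<subseteq> join_irreducibles L \<and> \<Squnion>M = x"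
  have "?P {i \<in> join_irreducibles L. i \<sqsubseteq> x}"
    using Sup_join_irreducibles_below[OF x] by auto
  then obtain M where M: "?P M" and min: "\<And>T. ?P T \<Longrightarrow> card M \<le> card T"
    using ex_has_least_nat[of ?P _ card] by metis
  have Mc: "M \<subseteq> carrier L"
    using M join_irreducibles_closed by blast
  have anti: "i = j" if ij: "i \<in> M" "j \<in> M" "i \<sqsubseteq> j" for i j
  proof (rule ccontr)
    assume "i \<noteq> j"
    have "\<Squnion>(M - {i}) = x"
    proof (rule Sup_eqI[OF _ x])
      fix u assume u: "u \<in> carrier L" "\<And>s. s \<in> M - {i} \<Longrightarrow> s \<sqsubseteq> u"
      have "i \<sqsubseteq> u"
        using u(1) u(2)[of j] ij \<open>i \<noteq> j\<close> Mc le_trans[of i j u] by auto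
      then show "x \<sqsubseteq> u"
        using u M Mc Sup_le[of M u] by blast
    qed (use M Mc Sup_upper[OF Mc] in auto)
    then have "card M \<le> card (M - {i})"
      using M min by blast
    moreover have "finite M"
      using Mc finite_carrier by (rule finite_subset)
    ultimately show False
      using ij by (metis card_Diff1_less not_le)
  qed
  have "\<eta>\<^sup>*\<^bsub>L\<^esub> x = M"
  proof (rule min_decomposition_eqI)
    show "M \<subseteq> join_irreducibles L" "\<Squnion>M = x"
      using M by auto
  qed (fact anti prime)+
  then show "\<eta>\<^sup>*\<^bsub>L\<^esub> x \<subseteq> join_irreducibles L" "\<Squnion>(\<eta>\<^sup>*\<^bsub>L\<^esub> x) = x"
    "\<And>i j. i \<in> \<eta>\<^sup>*\<^bsub>L\<^esub> x \<Longrightarrow> j \<in> \<eta>\<^sup>*\<^bsub>L\<^esub> x \<Longrightarrow> i \<sqsubseteq> j \<Longrightarrow> i = j"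
    using M anti by simp_all
qed

section \<open>Join-primes in distributive lattices and iterated differences\<close>

lemma distributive_join_irreducible_prime:
  assumes "distributive_lattice L" "i \<in> join_irreducibles L"
  shows "join_prime L i"
  unfolding join_prime_def
proof (intro conjI ballI impI)
  show i: "i \<in> carrier L" "i \<noteq> \<bottom>"
    using assms(2) by (auto simp: join_irreducibles_def)
  fix a b assume ab: "a \<in> carrier L" "b \<in> carrier L" "i \<sqsubseteq> a \<squnion> b"
  \<comment> \<open>Distributivity splits \<open>i\<close> into its meets with \<open>a\<close> and
    \<open>b\<close>, and irreducibility makes one of them equal to \<open>i\<close>.\<close>
  have "(i \<sqinter> a) \<squnion> (i \<sqinter> b) = i \<sqinter> (a \<squnion> b)"
    using assms ab i by (simp add: distributive_lattice_def)
  also have "\<dots> = i"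
    using ab i le_iff_join[of i "a \<squnion> b"] join_closed[of a b] by metis
  finally have "i \<sqinter> a = i \<or> i \<sqinter> b = i"
    using assms(2)[unfolded join_irreducible_iff] ab i meet_closed[of i a] meet_closed[of i b]
    by metis
  then show "i \<sqsubseteq> a \<or> i \<sqsubseteq> b"
    using ab i meet_right[of i a] meet_right[of i b] by metis
qed

text \<open>As \<open>z \<sqinter> i\<close> is strictly below \<open>i\<close>, it lies under the
  unique lower cover \<open>j\<close> and so under \<open>y\<close>. Expanding
  \<open>z \<sqinter> (y \<squnion> i)\<close> by distributivity then leaves only parts below
  \<open>y\<close>.\<close>

lemma distributive_below_join_cover:
  assumes dist: "distributive_lattice L" and i: "i \<in> join_irreducibles L" "covers L i j"
    and yz: "y \<in> carrier L" "z \<in> carrier L" "j \<sqsubseteq> y" "z \<sqsubseteq> y \<squnion> i" "\<not> i \<sqsubseteq> z"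
  shows "z \<sqsubseteq> y"
proof -
  have c: "i \<in> carrier L" "j \<in> carrier L"
    using i by (auto simp: covers_def)
  have "z \<sqinter> i \<sqsubset> i"
    using c yz meet_right[of z i] meet_left[of z i] by (auto simp: lless_eq)
  then obtain j' where "covers L i j'" "z \<sqinter> i \<sqsubseteq> j'"
    using lower_cover_above[of "z \<sqinter> i" i] c yz by auto
  then have "z \<sqinter> i \<sqsubseteq> j"
    using i by (auto simp: join_irreducibles_def)
  then have zi: "z \<sqinter> i \<sqsubseteq> y"
    using c yz le_trans[of "z \<sqinter> i" j y] by simp
  have "z = z \<sqinter> (y \<squnion> i)"
    using c yz le_iff_join[of z "y \<squnion> i"] join_closed[of y i] by metis
  also have "\<dots> = (z \<sqinter> y) \<squnion> (z \<sqinter> i)"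
    using dist c yz by (simp add: distributive_lattice_def)
  also have "\<dots> \<sqsubseteq> y"
    using zi c yz meet_right[of z y] by (intro join_le) auto
  finally show ?thesis .
qed

text \<open>Induction on the list of directions, with \<open>y\<close> varying. The fixed bound
  \<open>b\<close> is there because \<open>y\<close> moves upwards to \<open>y \<squnion> i\<close>
  and to \<open>y \<squnion> \<Squnion>(set js)\<close>, and the last but one group of assumptions
  must remain applicable at those points. The antichain condition keeps the remaining directions
  from falling under \<open>y \<squnion> i\<close>.\<close>

lemma foldr_deriv_moebius:
  assumes moebius: "moebius_transform L v m"
    and "set is \<subseteq> carrier L" "distinct is"
    and "\<And>i. i \<in> set is \<Longrightarrow> join_prime L i"
    and "\<And>i j. i \<in> set is \<Longrightarrow> j \<in> set is \<Longrightarrow> i \<sqsubseteq> j \<Longrightarrow> i = j"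
    and b: "b \<in> carrier L"
    and "\<And>i y z. i \<in> set is \<Longrightarrow> y \<in> carrier L \<Longrightarrow> z \<in> carrier L \<Longrightarrow> b \<sqsubseteq> y \<Longrightarrow>
      z \<sqsubseteq> y \<squnion> i \<Longrightarrow> \<not> i \<sqsubseteq> z \<Longrightarrow> z \<sqsubseteq> y"
    and "y \<in> carrier L" "b \<sqsubseteq> y" "\<And>i. i \<in> set is \<Longrightarrow> \<not> i \<sqsubseteq> y"
  shows "foldr (deriv1 L) is v y =
    (\<Sum>z\<in>{z \<in> carrier L. z \<sqsubseteq> y \<squnion> \<Squnion>(set is) \<and> (\<forall>i\<in>set is. i \<sqsubseteq> z)}. m z)"
  using assms(2-5,7-10)
proof (induction "is" arbitrary: y)
  case Nil
  then have "y \<squnion> \<bottom> = y"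
    using bottom_join[of y] join_comm[of L y \<bottom>] by (simp add: eq_is_equal)
  then show ?case
    using moebius Nil by (simp add: moebius_transform_def Sup_empty)
next
  case (Cons i js)
  let ?s = "\<Squnion>(set js)"
  let ?S = "\<lambda>y. {z \<in> carrier L. z \<sqsubseteq> y \<squnion> ?s \<and> (\<forall>i\<in>set js. i \<sqsubseteq> z)}"
  let ?g = "foldr (deriv1 L) js v"
  have i: "i \<in> carrier L" "join_prime L i" "\<not> i \<sqsubseteq> y" and js: "set js \<subseteq> carrier L" "i \<notin> set js"
    using Cons.prems(1-3) Cons.prems(8)[of i] by auto
  have s: "?s \<in> carrier L"
    using js by (simp add: Sup_closed)
  have y: "y \<in> carrier L" "b \<sqsubseteq> y" "b \<sqsubseteq> y \<squnion> i"
    using Cons.prems(6,7) b i le_trans[of b y "y \<squnion> i"] join_left[of y i] by auto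
  \<comment> \<open>The induction hypothesis is needed at two points, \<open>y\<close> and
    \<open>y \<squnion> i\<close>; for the second one \<open>nle\<close> supplies the side
    condition.\<close>
  have g: "?g y' = (\<Sum>z\<in>?S y'. m z)"
    if "y' \<in> carrier L" "b \<sqsubseteq> y'" "\<And>i. i \<in> set js \<Longrightarrow> \<not> i \<sqsubseteq> y'" for y'
  proof (rule Cons.IH)
    show "z \<sqsubseteq> y" if "j \<in> set js" "y \<in> carrier L" "z \<in> carrier L" "b \<sqsubseteq> y" "z \<sqsubseteq> y \<squnion> j" "\<not> j \<sqsubseteq> z"
      for j y z
      using Cons.prems(5)[of j y z] that by simp
    show "i' = j" if "i' \<in> set js" "j \<in> set js" "i' \<sqsubseteq> j" for i' j
      using Cons.prems(4)[of i' j] that by simp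
  qed (use that js Cons.prems(2,3) in simp_all)
  have nle: "\<not> j \<sqsubseteq> y \<squnion> i" if j: "j \<in> set js" for j
  proof
    assume "j \<sqsubseteq> y \<squnion> i"
    then have "j \<sqsubseteq> y \<or> j \<sqsubseteq> i"
      using Cons.prems(3)[of j] i y j by (auto simp: join_prime_def)
    then show False
      using Cons.prems(4)[of j i] Cons.prems(8)[of j] j js by auto
  qed
  have i_s: "\<not> i \<sqsubseteq> y \<squnion> ?s"
  proof
    assume "i \<sqsubseteq> y \<squnion> ?s"
    then have "i \<sqsubseteq> ?s"
      using i y s by (auto simp: join_prime_def)
    then obtain j where "j \<in> set js" "i \<sqsubseteq> j"
      using join_prime_Sup[of i "set js"] i js by auto
    then show False
      using Cons.prems(4)[of i j] js by auto
  qed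
  have comm: "(y \<squnion> i) \<squnion> ?s = (y \<squnion> ?s) \<squnion> i"
    using i y s by (metis eq_is_equal join_comm weak_join_assoc)
  have bs: "b \<sqsubseteq> y \<squnion> ?s"
    using b y s le_trans[of b y "y \<squnion> ?s"] join_left[of y ?s] by auto
  have "y \<squnion> ?s \<sqsubseteq> (y \<squnion> i) \<squnion> ?s"
    using comm i y s by (simp add: join_left)
  then have sub: "?S y \<subseteq> ?S (y \<squnion> i)"
    using i y s le_trans[of _ "y \<squnion> ?s" "(y \<squnion> i) \<squnion> ?s"] by auto
  \<comment> \<open>The terms surviving the subtraction are the \<open>z\<close> not below
    \<open>y \<squnion> ?s\<close>. The assumption on \<open>b\<close>, used at the point
    \<open>y \<squnion> ?s\<close>, puts \<open>i\<close> below each of them; by \<open>i_s\<close>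
    no other \<open>z\<close> lies above \<open>i\<close>.\<close>
  have diff: "?S (y \<squnion> i) - ?S y = {z \<in> carrier L. z \<sqsubseteq> y \<squnion> \<Squnion>(set (i # js)) \<and> (\<forall>i\<in>set (i # js). i \<sqsubseteq> z)}"
  proof -
    have "i \<sqsubseteq> z \<longleftrightarrow> \<not> z \<sqsubseteq> y \<squnion> ?s" if z: "z \<in> carrier L" "z \<sqsubseteq> (y \<squnion> i) \<squnion> ?s" for z
      using i_s z i y s bs Cons.prems(5)[of i "y \<squnion> ?s" z] le_trans[of i z "y \<squnion> ?s"]
      by (auto simp: comm)
    moreover have "y \<squnion> \<Squnion>(set (i # js)) = (y \<squnion> i) \<squnion> ?s"
      using i y s js weak_join_assoc[of y i ?s] by (simp add: Sup_insert eq_is_equal)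
    ultimately show ?thesis
      by auto
  qed
  have "foldr (deriv1 L) (i # js) v y = ?g (y \<squnion> i) - ?g y"
    using y by (simp add: deriv1_def)
  also have "\<dots> = (\<Sum>z\<in>?S (y \<squnion> i). m z) - (\<Sum>z\<in>?S y. m z)"
    using g[of "y \<squnion> i"] g[of y] y i nle Cons.prems(8) by simp
  also have "\<dots> = (\<Sum>z\<in>?S (y \<squnion> i) - ?S y. m z)"
    using sub finite_carrier by (subst sum_diff) auto
  finally show ?case
    by (simp only: diff)
qed

end

section \<open>Finite products of lattices\<close>

locale lattice_family =
  fixes n :: nat and L :: "nat \<Rightarrow> 'a gorder"
  assumes fin_lattice: "k \<in> {1..n} \<Longrightarrow> fin_lattice (L k)"
begin

section \<open>The componentwise order as a finite lattice\<close>

lemma product_carrier_iff: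
  "x \<in> carrier (product_order n L) \<longleftrightarrow> x \<in> (\<Pi>\<^sub>E k\<in>{1..n}. carrier (L k))"
  by (simp add: product_order_def)

lemma product_closed: "x \<in> carrier (product_order n L) \<Longrightarrow> k \<in> {1..n} \<Longrightarrow> x k \<in> carrier (L k)"
  by (auto simp: product_carrier_iff)

lemma product_le_iff: "x \<sqsubseteq>\<^bsub>product_order n L\<^esub> y \<longleftrightarrow> (\<forall>k\<in>{1..n}. x k \<sqsubseteq>\<^bsub>L k\<^esub> y k)"
  by (simp add: product_order_def)

lemma product_eqI:
  assumes "x \<in> carrier (product_order n L)" "y \<in> carrier (product_order n L)"
    "\<And>k. k \<in> {1..n} \<Longrightarrow> x k = y k"
  shows "x = y"
  using assms unfolding product_carrier_iff by (rule PiE_ext)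

text \<open>The form with \<open>least\<close> serves twice: it gives the existence of joins in
  \<open>product_fin_lattice\<close> and, by uniqueness of least upper bounds, their coordinatewise
  computation in \<open>product_join\<close>.\<close>

lemma product_join_least:
  assumes xy: "x \<in> carrier (product_order n L)" "y \<in> carrier (product_order n L)"
  shows "least (product_order n L) (\<lambda>k\<in>{1..n}. x k \<squnion>\<^bsub>L k\<^esub> y k) (Upper (product_order n L) {x, y})"
proof -
  let ?s = "\<lambda>k\<in>{1..n}. x k \<squnion>\<^bsub>L k\<^esub> y k"
  have "x k \<squnion>\<^bsub>L k\<^esub> y k \<in> carrier (L k) \<and> x k \<sqsubseteq>\<^bsub>L k\<^esub> x k \<squnion>\<^bsub>L k\<^esub> y k \<and>
      y k \<sqsubseteq>\<^bsub>L k\<^esub> x k \<squnion>\<^bsub>L k\<^esub> y k" if k: "k \<in> {1..n}" for k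
  proof -
    interpret Lk: fin_lattice "L k"
      using k by (rule fin_lattice)
    show ?thesis
      using product_closed[OF _ k] xy Lk.join_left Lk.join_right by auto
  qed
  then have "?s \<in> Upper (product_order n L) {x, y}"
    by (auto simp: Upper_def product_le_iff product_carrier_iff)
  moreover have "?s \<sqsubseteq>\<^bsub>product_order n L\<^esub> u" if u: "u \<in> Upper (product_order n L) {x, y}" for u
    unfolding product_le_iff
  proof
    fix k assume k: "k \<in> {1..n}"
    interpret Lk: fin_lattice "L k"
      using k by (rule fin_lattice)
    have "u \<in> carrier (product_order n L)" "x k \<sqsubseteq>\<^bsub>L k\<^esub> u k" "y k \<sqsubseteq>\<^bsub>L k\<^esub> u k"
      using u xy k by (auto simp: Upper_def product_le_iff)
    then show "?s k \<sqsubseteq>\<^bsub>L k\<^esub> u k"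
      using k product_closed[OF _ k] xy by (auto intro: Lk.join_le)
  qed
  ultimately show ?thesis
    by (auto simp: least_def Upper_def)
qed

lemma product_meet_greatest:
  assumes xy: "x \<in> carrier (product_order n L)" "y \<in> carrier (product_order n L)"
  shows "greatest (product_order n L) (\<lambda>k\<in>{1..n}. x k \<sqinter>\<^bsub>L k\<^esub> y k) (Lower (product_order n L) {x, y})"
proof -
  let ?s = "\<lambda>k\<in>{1..n}. x k \<sqinter>\<^bsub>L k\<^esub> y k"
  have "x k \<sqinter>\<^bsub>L k\<^esub> y k \<in> carrier (L k) \<and> x k \<sqinter>\<^bsub>L k\<^esub> y k \<sqsubseteq>\<^bsub>L k\<^esub> x k \<and>
      x k \<sqinter>\<^bsub>L k\<^esub> y k \<sqsubseteq>\<^bsub>L k\<^esub> y k" if k: "k \<in> {1..n}" for k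
  proof -
    interpret Lk: fin_lattice "L k"
      using k by (rule fin_lattice)
    show ?thesis
      using product_closed[OF _ k] xy Lk.meet_left Lk.meet_right by auto
  qed
  then have "?s \<in> Lower (product_order n L) {x, y}"
    by (auto simp: Lower_def product_le_iff product_carrier_iff)
  moreover have "u \<sqsubseteq>\<^bsub>product_order n L\<^esub> ?s" if u: "u \<in> Lower (product_order n L) {x, y}" for u
    unfolding product_le_iff
  proof
    fix k assume k: "k \<in> {1..n}"
    interpret Lk: fin_lattice "L k"
      using k by (rule fin_lattice)
    have "u \<in> carrier (product_order n L)" "u k \<sqsubseteq>\<^bsub>L k\<^esub> x k" "u k \<sqsubseteq>\<^bsub>L k\<^esub> y k"
      using u xy k by (auto simp: Lower_def product_le_iff)
    then show "u k \<sqsubseteq>\<^bsub>L k\<^esub> ?s k"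
      using k product_closed[OF _ k] xy by (auto intro: Lk.meet_le)
  qed
  ultimately show ?thesis
    by (auto simp: greatest_def Lower_def)
qed

lemma component_bounded:
  assumes "k \<in> {1..n}"
  shows "\<bottom>\<^bsub>L k\<^esub> \<in> carrier (L k)" "\<top>\<^bsub>L k\<^esub> \<in> carrier (L k)"
    "a \<in> carrier (L k) \<Longrightarrow> \<bottom>\<^bsub>L k\<^esub> \<sqsubseteq>\<^bsub>L k\<^esub> a" "a \<in> carrier (L k) \<Longrightarrow> a \<sqsubseteq>\<^bsub>L k\<^esub> \<top>\<^bsub>L k\<^esub>"
proof -
  interpret Lk: fin_lattice "L k"
    using assms by (rule fin_lattice)
  show "\<bottom>\<^bsub>L k\<^esub> \<in> carrier (L k)" "\<top>\<^bsub>L k\<^esub> \<in> carrier (L k)"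
    "a \<in> carrier (L k) \<Longrightarrow> \<bottom>\<^bsub>L k\<^esub> \<sqsubseteq>\<^bsub>L k\<^esub> a" "a \<in> carrier (L k) \<Longrightarrow> a \<sqsubseteq>\<^bsub>L k\<^esub> \<top>\<^bsub>L k\<^esub>"
    by auto
qed

lemma product_bottom_least:
  "least (product_order n L) (\<lambda>k\<in>{1..n}. \<bottom>\<^bsub>L k\<^esub>) (carrier (product_order n L))"
  using component_bounded product_closed
  by (auto simp: least_def product_carrier_iff product_le_iff)

lemma product_top_greatest:
  "greatest (product_order n L) (\<lambda>k\<in>{1..n}. \<top>\<^bsub>L k\<^esub>) (carrier (product_order n L))"
  using component_bounded product_closed
  by (auto simp: greatest_def product_carrier_iff product_le_iff)

lemma product_partial_order: "partial_order (product_order n L)"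
proof
  show eq: "(.=\<^bsub>product_order n L\<^esub>) = (=)"
    by (simp add: product_order_def)
  fix x y z
  assume x: "x \<in> carrier (product_order n L)"
  show "x \<sqsubseteq>\<^bsub>product_order n L\<^esub> x"
    unfolding product_le_iff
  proof
    fix k assume k: "k \<in> {1..n}"
    interpret Lk: fin_lattice "L k"
      using k by (rule fin_lattice)
    show "x k \<sqsubseteq>\<^bsub>L k\<^esub> x k"
      using product_closed[OF x k] by simp
  qed
  show "x .=\<^bsub>product_order n L\<^esub> y"
    if y: "y \<in> carrier (product_order n L)"
      and le: "x \<sqsubseteq>\<^bsub>product_order n L\<^esub> y" "y \<sqsubseteq>\<^bsub>product_order n L\<^esub> x"
    unfolding eq
  proof (rule product_eqI[OF x y])
    fix k assume k: "k \<in> {1..n}"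
    interpret Lk: fin_lattice "L k"
      using k by (rule fin_lattice)
    show "x k = y k"
      using le k product_closed[OF x k] product_closed[OF y k]
      by (auto simp: product_le_iff intro: Lk.le_antisym)
  qed
  show "x \<sqsubseteq>\<^bsub>product_order n L\<^esub> z"
    if y: "y \<in> carrier (product_order n L)" and z: "z \<in> carrier (product_order n L)"
      and le: "x \<sqsubseteq>\<^bsub>product_order n L\<^esub> y" "y \<sqsubseteq>\<^bsub>product_order n L\<^esub> z"
    unfolding product_le_iff
  proof
    fix k assume k: "k \<in> {1..n}"
    interpret Lk: fin_lattice "L k"
      using k by (rule fin_lattice)
    show "x k \<sqsubseteq>\<^bsub>L k\<^esub> z k"
      using le k product_closed[OF x k] product_closed[OF y k] product_closed[OF z k]
        Lk.le_trans[of "x k" "y k" "z k"]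
      by (auto simp: product_le_iff)
  qed
qed (simp_all add: product_order_def)

lemma product_fin_lattice: "fin_lattice (product_order n L)"
proof -
  interpret P: partial_order "product_order n L"
    by (rule product_partial_order)
  show ?thesis
  proof
    show "finite (carrier (product_order n L))"
      using fin_lattice by (auto simp: product_order_def fin_lattice_def fin_lattice_axioms_def
          intro!: finite_PiE)
  qed (use product_join_least product_meet_greatest product_bottom_least product_top_greatest in blast)+
qed

end

sublocale lattice_family \<subseteq> P: fin_lattice "product_order n L"
  by (rule product_fin_lattice)

context lattice_family
begin

lemma product_join:
  assumes "x \<in> carrier (product_order n L)" "y \<in> carrier (product_order n L)" "k \<in> {1..n}"
  shows "(x \<squnion>\<^bsub>product_order n L\<^esub> y) k = x k \<squnion>\<^bsub>L k\<^esub> y k"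
  using P.least_unique[OF P.sup_of_two_least[OF assms(1,2)] product_join_least[OF assms(1,2)]] assms(3)
  by (simp add: join_def)

lemma product_bottom: "k \<in> {1..n} \<Longrightarrow> \<bottom>\<^bsub>product_order n L\<^esub> k = \<bottom>\<^bsub>L k\<^esub>"
  using P.least_unique[OF P.bottom_least product_bottom_least] by simp

section \<open>Elements supported on one coordinate and the join-irreducibles of the product\<close>

definition emb :: "nat \<Rightarrow> 'a \<Rightarrow> nat \<Rightarrow> 'a" where
  "emb k a = (\<lambda>l\<in>{1..n}. if l = k then a else \<bottom>\<^bsub>L l\<^esub>)"

lemma emb_apply: "l \<in> {1..n} \<Longrightarrow> emb k a l = (if l = k then a else \<bottom>\<^bsub>L l\<^esub>)"
  by (simp add: emb_def)

lemma emb_closed: "a \<in> carrier (L k) \<Longrightarrow> emb k a \<in> carrier (product_order n L)"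
  using component_bounded by (auto simp: product_carrier_iff emb_def)

lemma emb_le_iff:
  assumes "k \<in> {1..n}" "z \<in> carrier (product_order n L)"
  shows "emb k a \<sqsubseteq>\<^bsub>product_order n L\<^esub> z \<longleftrightarrow> a \<sqsubseteq>\<^bsub>L k\<^esub> z k"
  using assms component_bounded(3)[OF _ product_closed[OF assms(2)]]
  by (auto simp: product_le_iff emb_apply)

lemma component_join_bottom:
  assumes "k \<in> {1..n}" "a \<in> carrier (L k)"
  shows "a \<squnion>\<^bsub>L k\<^esub> \<bottom>\<^bsub>L k\<^esub> = a" "\<bottom>\<^bsub>L k\<^esub> \<squnion>\<^bsub>L k\<^esub> a = a"
proof -
  interpret Lk: fin_lattice "L k"
    using assms(1) by (rule fin_lattice)
  show "\<bottom>\<^bsub>L k\<^esub> \<squnion>\<^bsub>L k\<^esub> a = a"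
    using Lk.bottom_join[OF assms(2)] by (simp add: Lk.eq_is_equal)
  then show "a \<squnion>\<^bsub>L k\<^esub> \<bottom>\<^bsub>L k\<^esub> = a"
    by (simp add: join_comm[of "L k" a])
qed

lemma emb_join:
  assumes k: "k \<in> {1..n}" and ab: "a \<in> carrier (L k)" "b \<in> carrier (L k)"
  shows "emb k a \<squnion>\<^bsub>product_order n L\<^esub> emb k b = emb k (a \<squnion>\<^bsub>L k\<^esub> b)"
proof (rule product_eqI)
  interpret Lk: fin_lattice "L k"
    using k by (rule fin_lattice)
  show "emb k a \<squnion>\<^bsub>product_order n L\<^esub> emb k b \<in> carrier (product_order n L)"
    using ab emb_closed by simp
  show "emb k (a \<squnion>\<^bsub>L k\<^esub> b) \<in> carrier (product_order n L)"
    using ab by (intro emb_closed) simp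
  fix l assume l: "l \<in> {1..n}"
  show "(emb k a \<squnion>\<^bsub>product_order n L\<^esub> emb k b) l = emb k (a \<squnion>\<^bsub>L k\<^esub> b) l"
    using l ab emb_closed component_bounded(1)[OF l]
    by (simp add: product_join emb_apply component_join_bottom)
qed

lemma emb_eq_bottom_iff:
  assumes k: "k \<in> {1..n}"
  shows "emb k a = \<bottom>\<^bsub>product_order n L\<^esub> \<longleftrightarrow> a = \<bottom>\<^bsub>L k\<^esub>"
proof
  assume "emb k a = \<bottom>\<^bsub>product_order n L\<^esub>"
  then have "emb k a k = \<bottom>\<^bsub>L k\<^esub>"
    using product_bottom[OF k] by simp
  then show "a = \<bottom>\<^bsub>L k\<^esub>"
    using k by (simp add: emb_apply)
next
  assume a: "a = \<bottom>\<^bsub>L k\<^esub>"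
  show "emb k a = \<bottom>\<^bsub>product_order n L\<^esub>"
  proof (rule product_eqI)
    show "emb k a \<in> carrier (product_order n L)"
      using a component_bounded(1)[OF k] by (simp add: emb_closed)
  qed (simp_all add: a product_bottom emb_apply)
qed

lemma emb_inject: "k \<in> {1..n} \<Longrightarrow> emb k a = emb k b \<Longrightarrow> a = b"
  by (metis emb_apply)

text \<open>If a join equals \<open>emb k a\<close>, both of its arguments are bottom outside
  coordinate \<open>k\<close>. The splitting therefore takes place inside \<open>L k\<close>, where
  irreducibility of \<open>a\<close> makes it trivial.\<close>

lemma emb_join_irreducible:
  assumes k: "k \<in> {1..n}" and a: "a \<in> join_irreducibles (L k)"
  shows "emb k a \<in> join_irreducibles (product_order n L)"
proof -
  interpret Lk: fin_lattice "L k"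
    using k by (rule fin_lattice)
  have ac: "a \<in> carrier (L k)" "a \<noteq> \<bottom>\<^bsub>L k\<^esub>"
    using a by (auto simp: join_irreducibles_def)
  have "y = emb k a \<or> z = emb k a"
    if yz: "y \<in> carrier (product_order n L)" "z \<in> carrier (product_order n L)"
      and eq: "y \<squnion>\<^bsub>product_order n L\<^esub> z = emb k a" for y z
  proof -
    have eql: "y l \<squnion>\<^bsub>L l\<^esub> z l = emb k a l" if "l \<in> {1..n}" for l
      using product_join[OF yz that] eq by simp
    have bot: "y l = emb k a l \<and> z l = emb k a l" if l: "l \<in> {1..n}" "l \<noteq> k" for l
    proof -
      interpret Ll: fin_lattice "L l"
        using l(1) by (rule fin_lattice)
      have c: "y l \<in> carrier (L l)" "z l \<in> carrier (L l)"
        using product_closed yz l by auto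
      then have "y l \<sqsubseteq>\<^bsub>L l\<^esub> \<bottom>\<^bsub>L l\<^esub>" "z l \<sqsubseteq>\<^bsub>L l\<^esub> \<bottom>\<^bsub>L l\<^esub>"
        using eql[OF l(1)] l Ll.join_left[of "y l" "z l"] Ll.join_right[of "y l" "z l"]
        by (auto simp: emb_apply)
      then have "y l = \<bottom>\<^bsub>L l\<^esub>" "z l = \<bottom>\<^bsub>L l\<^esub>"
        using c Ll.le_antisym[of "y l" "\<bottom>\<^bsub>L l\<^esub>"] Ll.le_antisym[of "z l" "\<bottom>\<^bsub>L l\<^esub>"] by auto
      then show ?thesis
        using l by (simp add: emb_apply)
    qed
    have "y k \<squnion>\<^bsub>L k\<^esub> z k = a"
      using eql[OF k] k by (simp add: emb_apply)
    then have "y k = a \<or> z k = a"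
      using a[unfolded Lk.join_irreducible_iff] product_closed[OF yz(1) k]
        product_closed[OF yz(2) k] by metis
    then show ?thesis
    proof
      assume "y k = a"
      then have "y l = emb k a l" if "l \<in> {1..n}" for l
        using bot[of l] that by (cases "l = k") (auto simp: emb_apply)
      then show ?thesis
        using product_eqI[OF yz(1) emb_closed[OF ac(1)]] by blast
    next
      assume "z k = a"
      then have "z l = emb k a l" if "l \<in> {1..n}" for l
        using bot[of l] that by (cases "l = k") (auto simp: emb_apply)
      then show ?thesis
        using product_eqI[OF yz(2) emb_closed[OF ac(1)]] by blast
    qed
  qed
  then show ?thesis
    using ac k emb_closed emb_eq_bottom_iff unfolding P.join_irreducible_iff by blast
qed

text \<open>Choose a coordinate \<open>k\<close> where \<open>t\<close> is not the bottom and write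
  \<open>t\<close> as the join of its part in coordinate \<open>k\<close> and the remainder
  \<open>r\<close>. Since \<open>r\<close> differs from \<open>t\<close> at \<open>k\<close>,
  irreducibility leaves only the first part.\<close>

lemma product_join_irreducible_cases:
  assumes t: "t \<in> join_irreducibles (product_order n L)"
  obtains k a where "k \<in> {1..n}" "a \<in> join_irreducibles (L k)" "t = emb k a"
proof -
  have tc: "t \<in> carrier (product_order n L)" "t \<noteq> \<bottom>\<^bsub>product_order n L\<^esub>"
    using t by (auto simp: join_irreducibles_def)
  have irr: "a = t \<or> b = t" if "a \<in> carrier (product_order n L)" "b \<in> carrier (product_order n L)"
    "a \<squnion>\<^bsub>product_order n L\<^esub> b = t" for a b
    using t that unfolding P.join_irreducible_iff by blast
  obtain k where k: "k \<in> {1..n}" "t k \<noteq> \<bottom>\<^bsub>L k\<^esub>"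
    using product_eqI[OF tc(1) P.bottom_closed] product_bottom tc by metis
  have tk: "t k \<in> carrier (L k)"
    using product_closed tc k by blast
  interpret Lk: fin_lattice "L k"
    using k(1) by (rule fin_lattice)
  define r where "r = (\<lambda>l\<in>{1..n}. if l = k then \<bottom>\<^bsub>L l\<^esub> else t l)"
  have r: "r \<in> carrier (product_order n L)"
    using tc component_bounded(1) by (auto simp: r_def product_carrier_iff)
  have "emb k (t k) \<squnion>\<^bsub>product_order n L\<^esub> r = t"
  proof (rule product_eqI)
    show "emb k (t k) \<squnion>\<^bsub>product_order n L\<^esub> r \<in> carrier (product_order n L)"
      using emb_closed[OF tk] r by simp
    fix l assume l: "l \<in> {1..n}"
    show "(emb k (t k) \<squnion>\<^bsub>product_order n L\<^esub> r) l = t l"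
      unfolding product_join[OF emb_closed[OF tk] r l]
      using l product_closed[OF tc(1) l]
      by (cases "l = k") (simp_all add: emb_apply r_def component_join_bottom)
  qed fact
  then have "emb k (t k) = t \<or> r = t"
    by (rule irr[OF emb_closed[OF tk] r])
  moreover have "r k \<noteq> t k"
    using k by (simp add: r_def)
  ultimately have temb: "t = emb k (t k)"
    by auto
  \<comment> \<open>A splitting of \<open>t k\<close> lifts through \<open>emb\<close> to a
    splitting of \<open>t\<close>, so irreducibility descends to the coordinate.\<close>
  have "a = t k \<or> b = t k" if ab: "a \<in> carrier (L k)" "b \<in> carrier (L k)" "a \<squnion>\<^bsub>L k\<^esub> b = t k" for a b
  proof -
    have "emb k a \<squnion>\<^bsub>product_order n L\<^esub> emb k b = t"
      using emb_join[OF k(1) ab(1,2)] ab(3) temb by simp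
    then have "emb k a = t \<or> emb k b = t"
      using irr[OF emb_closed[OF ab(1)] emb_closed[OF ab(2)]] by blast
    then show ?thesis
      using temb emb_inject[OF k(1)] by metis
  qed
  then have "t k \<in> join_irreducibles (L k)"
    using tk k unfolding Lk.join_irreducible_iff by blast
  then show thesis
    using that k temb by blast
qed

section \<open>Minimal decompositions and derivatives in the product\<close>

lemma emb_join_prime:
  assumes k: "k \<in> {1..n}" and a: "join_prime (L k) a"
  shows "join_prime (product_order n L) (emb k a)"
proof -
  have ac: "a \<in> carrier (L k)" "a \<noteq> \<bottom>\<^bsub>L k\<^esub>"
    using a by (auto simp: join_prime_def)
  have "emb k a \<sqsubseteq>\<^bsub>product_order n L\<^esub> y \<or> emb k a \<sqsubseteq>\<^bsub>product_order n L\<^esub> z"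
    if yz: "y \<in> carrier (product_order n L)" "z \<in> carrier (product_order n L)"
      and le: "emb k a \<sqsubseteq>\<^bsub>product_order n L\<^esub> y \<squnion>\<^bsub>product_order n L\<^esub> z" for y z
  proof -
    have "a \<sqsubseteq>\<^bsub>L k\<^esub> y k \<squnion>\<^bsub>L k\<^esub> z k"
      using le emb_le_iff[OF k P.join_closed[OF yz]] product_join[OF yz k] by simp
    then have "a \<sqsubseteq>\<^bsub>L k\<^esub> y k \<or> a \<sqsubseteq>\<^bsub>L k\<^esub> z k"
      using a product_closed[OF _ k] yz by (simp add: join_prime_def)
    then show ?thesis
      using emb_le_iff[OF k] yz by simp
  qed
  then show ?thesis
    using ac k emb_closed emb_eq_bottom_iff by (simp add: join_prime_def)
qed

text \<open>The embedded coordinate decompositions together satisfy the conditions of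
  \<open>min_decomposition_eqI\<close>. Elements from different coordinates are incomparable because
  neither is the bottom, and within one coordinate the antichain property is inherited.\<close>

lemma product_min_decomposition:
  assumes K: "K \<subseteq> {1..n}" and dist: "\<And>k. k \<in> K \<Longrightarrow> distributive_lattice (L k)"
    and x: "x \<in> carrier (product_order n L)" and bot: "\<And>k. k \<in> {1..n} - K \<Longrightarrow> x k = \<bottom>\<^bsub>L k\<^esub>"
  shows "\<eta>\<^sup>*\<^bsub>product_order n L\<^esub> x = (\<Union>k\<in>K. emb k ` \<eta>\<^sup>*\<^bsub>L k\<^esub> (x k))" (is "_ = ?M")
    and "\<Squnion>\<^bsub>product_order n L\<^esub>(\<eta>\<^sup>*\<^bsub>product_order n L\<^esub> x) = x"
    and "\<And>i j. i \<in> \<eta>\<^sup>*\<^bsub>product_order n L\<^esub> x \<Longrightarrow> j \<in> \<eta>\<^sup>*\<^bsub>product_order n L\<^esub> x \<Longrightarrow>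
      i \<sqsubseteq>\<^bsub>product_order n L\<^esub> j \<Longrightarrow> i = j"
proof -
  have comp: "\<eta>\<^sup>*\<^bsub>L k\<^esub> (x k) \<subseteq> join_irreducibles (L k) \<and> \<Squnion>\<^bsub>L k\<^esub>(\<eta>\<^sup>*\<^bsub>L k\<^esub> (x k)) = x k \<and>
      (\<forall>i\<in>\<eta>\<^sup>*\<^bsub>L k\<^esub> (x k). \<forall>j\<in>\<eta>\<^sup>*\<^bsub>L k\<^esub> (x k). i \<sqsubseteq>\<^bsub>L k\<^esub> j \<longrightarrow> i = j)" if k: "k \<in> K" for k
  proof -
    have kn: "k \<in> {1..n}"
      using k K by blast
    interpret Lk: fin_lattice "L k"
      using kn by (rule fin_lattice)
    show ?thesis
      using Lk.min_decomposition_antichain[OF product_closed[OF x kn]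
          Lk.distributive_join_irreducible_prime[OF dist[OF k]]] by blast
  qed
  have closed: "a \<in> carrier (L k)" "a \<noteq> \<bottom>\<^bsub>L k\<^esub>" if "k \<in> K" "a \<in> \<eta>\<^sup>*\<^bsub>L k\<^esub> (x k)" for k a
    using comp[OF that(1)] that(2) by (auto simp: join_irreducibles_def)
  have M: "?M \<subseteq> join_irreducibles (product_order n L)"
    using comp K emb_join_irreducible by blast
  then have Mc: "?M \<subseteq> carrier (product_order n L)"
    using P.join_irreducibles_closed by blast
  have Sup: "\<Squnion>\<^bsub>product_order n L\<^esub>?M = x"
  proof (rule P.Sup_eqI[OF Mc x])
    fix s assume "s \<in> ?M"
    then obtain k a where k: "k \<in> K" "a \<in> \<eta>\<^sup>*\<^bsub>L k\<^esub> (x k)" "s = emb k a"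
      by blast
    have kn: "k \<in> {1..n}"
      using k K by blast
    interpret Lk: fin_lattice "L k"
      using kn by (rule fin_lattice)
    have "a \<sqsubseteq>\<^bsub>L k\<^esub> \<Squnion>\<^bsub>L k\<^esub>(\<eta>\<^sup>*\<^bsub>L k\<^esub> (x k))"
      using k closed by (intro Lk.Sup_upper) auto
    then show "s \<sqsubseteq>\<^bsub>product_order n L\<^esub> x"
      using k comp[OF k(1)] emb_le_iff[OF kn x] by simp
  next
    fix u assume u: "u \<in> carrier (product_order n L)" "\<And>s. s \<in> ?M \<Longrightarrow> s \<sqsubseteq>\<^bsub>product_order n L\<^esub> u"
    show "x \<sqsubseteq>\<^bsub>product_order n L\<^esub> u"
      unfolding product_le_iff
    proof
      fix k assume kn: "k \<in> {1..n}"
      interpret Lk: fin_lattice "L k"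
        using kn by (rule fin_lattice)
      show "x k \<sqsubseteq>\<^bsub>L k\<^esub> u k"
      proof (cases "k \<in> K")
        case True
        have "a \<sqsubseteq>\<^bsub>L k\<^esub> u k" if "a \<in> \<eta>\<^sup>*\<^bsub>L k\<^esub> (x k)" for a
          using u(2)[of "emb k a"] that True emb_le_iff[OF kn u(1)] by blast
        then have "\<Squnion>\<^bsub>L k\<^esub>(\<eta>\<^sup>*\<^bsub>L k\<^esub> (x k)) \<sqsubseteq>\<^bsub>L k\<^esub> u k"
          using closed[OF True] product_closed[OF u(1) kn] by (intro Lk.Sup_le) auto
        then show ?thesis
          using comp[OF True] by simp
      next
        case False
        then show ?thesis
          using bot[of k] kn product_closed[OF u(1) kn] by simp
      qed
    qed
  qed
  have anti: "i = j" if ij: "i \<in> ?M" "j \<in> ?M" "i \<sqsubseteq>\<^bsub>product_order n L\<^esub> j" for i j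
  proof -
    obtain k a where k: "k \<in> K" "a \<in> \<eta>\<^sup>*\<^bsub>L k\<^esub> (x k)" "i = emb k a"
      using ij by blast
    obtain l b where l: "l \<in> K" "b \<in> \<eta>\<^sup>*\<^bsub>L l\<^esub> (x l)" "j = emb l b"
      using ij by blast
    have kn: "k \<in> {1..n}"
      using k K by blast
    interpret Lk: fin_lattice "L k"
      using kn by (rule fin_lattice)
    have le: "a \<sqsubseteq>\<^bsub>L k\<^esub> emb l b k"
      using ij(3) k l emb_le_iff[OF kn emb_closed[OF closed(1)[OF l(1,2)]]] by simp
    have "k = l"
    proof (rule ccontr)
      assume "k \<noteq> l"
      then have "a \<sqsubseteq>\<^bsub>L k\<^esub> \<bottom>\<^bsub>L k\<^esub>"
        using le kn by (simp add: emb_apply)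
      then have "a = \<bottom>\<^bsub>L k\<^esub>"
        using closed[OF k(1,2)] by (intro Lk.le_antisym) auto
      then show False
        using closed[OF k(1,2)] by simp
    qed
    moreover from this have "a \<sqsubseteq>\<^bsub>L k\<^esub> b"
      using le kn by (simp add: emb_apply)
    ultimately show ?thesis
      using comp[OF k(1)] k l by blast
  qed
  \<comment> \<open>Since \<open>x\<close> is bottom outside \<open>K\<close>, a join-irreducible
    below \<open>x\<close> is supported on a coordinate in \<open>K\<close>, and that coordinate is
    distributive.\<close>
  have prime: "join_prime (product_order n L) i"
    if i: "i \<in> join_irreducibles (product_order n L)" "i \<sqsubseteq>\<^bsub>product_order n L\<^esub> x" for i
  proof -
    obtain k a where k: "k \<in> {1..n}" "a \<in> join_irreducibles (L k)" "i = emb k a"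
      using product_join_irreducible_cases[OF i(1)] by blast
    interpret Lk: fin_lattice "L k"
      using k(1) by (rule fin_lattice)
    have a: "a \<in> carrier (L k)" "a \<noteq> \<bottom>\<^bsub>L k\<^esub>"
      using k by (auto simp: join_irreducibles_def)
    have "k \<in> K"
    proof (rule ccontr)
      assume "k \<notin> K"
      then have "a \<sqsubseteq>\<^bsub>L k\<^esub> \<bottom>\<^bsub>L k\<^esub>"
        using bot[of k] i(2) k emb_le_iff[OF k(1) x] by simp
      then have "a = \<bottom>\<^bsub>L k\<^esub>"
        using a by (intro Lk.le_antisym) auto
      then show False
        using a by simp
    qed
    then show ?thesis
      using emb_join_prime[OF k(1) Lk.distributive_join_irreducible_prime[OF dist k(2)]] k(3) by simp
  qed
  show eq: "\<eta>\<^sup>*\<^bsub>product_order n L\<^esub> x = ?M"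
    by (rule P.min_decomposition_eqI[OF M Sup anti prime])
  show "\<Squnion>\<^bsub>product_order n L\<^esub>(\<eta>\<^sup>*\<^bsub>product_order n L\<^esub> x) = x"
    unfolding eq by (rule Sup)
  show "i = j" if "i \<in> \<eta>\<^sup>*\<^bsub>product_order n L\<^esub> x" "j \<in> \<eta>\<^sup>*\<^bsub>product_order n L\<^esub> x"
      "i \<sqsubseteq>\<^bsub>product_order n L\<^esub> j" for i j
    using that unfolding eq by (rule anti)
qed

text \<open>The minimal decomposition of \<open>x\<close> provides the directions for
  \<open>foldr_deriv_moebius\<close>. Joining with an embedded \<open>a\<close> changes a single
  coordinate, which lies in \<open>K\<close>, so the condition on \<open>z\<close> there follows
  from \<open>distributive_below_join_cover\<close> and is immediate in all others.\<close>

lemma lattice_deriv_moebius: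
  assumes K: "K \<subseteq> {1..n}" and dist: "\<And>k. k \<in> K \<Longrightarrow> distributive_lattice (L k)"
    and x: "x \<in> carrier (product_order n L)" and bot: "\<And>k. k \<in> {1..n} - K \<Longrightarrow> x k = \<bottom>\<^bsub>L k\<^esub>"
    and moebius: "moebius_transform (product_order n L) v m"
    and y: "y \<in> carrier (product_order n L)"
    and cover: "\<And>k i. k \<in> K \<Longrightarrow> i \<in> \<eta>\<^sup>*\<^bsub>L k\<^esub> (x k) \<Longrightarrow> covers (L k) i (y k)"
  shows "lattice_deriv (product_order n L) x v y =
    (\<Sum>z\<in>\<lbrace>x..y \<squnion>\<^bsub>product_order n L\<^esub> x\<rbrace>\<^bsub>product_order n L\<^esub>. m z)"
proof -
  let ?M = "\<eta>\<^sup>*\<^bsub>product_order n L\<^esub> x"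
  have eta: "?M = (\<Union>k\<in>K. emb k ` \<eta>\<^sup>*\<^bsub>L k\<^esub> (x k))" "\<Squnion>\<^bsub>product_order n L\<^esub>?M = x"
    using product_min_decomposition(1,2)[OF K dist x bot] by blast+
  have elem: "\<exists>k a. k \<in> K \<and> k \<in> {1..n} \<and> a \<in> join_irreducibles (L k) \<and> covers (L k) a (y k) \<and> i = emb k a"
    if i: "i \<in> ?M" for i
  proof -
    obtain k a where k: "k \<in> K" "a \<in> \<eta>\<^sup>*\<^bsub>L k\<^esub> (x k)" "i = emb k a"
      using i unfolding eta(1) by blast
    have kn: "k \<in> {1..n}"
      using k K by blast
    interpret Lk: fin_lattice "L k"
      using kn by (rule fin_lattice)
    have "a \<in> join_irreducibles (L k)"
      using k(2) Lk.min_decomposition_antichain(1)[OF product_closed[OF x kn]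
          Lk.distributive_join_irreducible_prime[OF dist[OF k(1)]]] by blast
    then show ?thesis
      using k kn cover by blast
  qed
  have Mc: "?M \<subseteq> carrier (product_order n L)"
    using elem emb_closed by (fastforce simp: join_irreducibles_def)
  then obtain js where js: "set js = ?M" "distinct js"
    using finite_subset[OF _ P.finite_carrier] finite_distinct_list by metis
  have "lattice_deriv (product_order n L) x v y = foldr (deriv1 (product_order n L)) js v y"
    using lattice_deriv_eq_foldr[OF P.lattice_axioms js] Mc js by simp
  also have "\<dots> = (\<Sum>z\<in>{z \<in> carrier (product_order n L).
      z \<sqsubseteq>\<^bsub>product_order n L\<^esub> y \<squnion>\<^bsub>product_order n L\<^esub> \<Squnion>\<^bsub>product_order n L\<^esub>(set js) \<and>
      (\<forall>i\<in>set js. i \<sqsubseteq>\<^bsub>product_order n L\<^esub> z)}. m z)"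
  \<comment> \<open>The bound \<open>b\<close> is instantiated by \<open>y\<close> itself: any
    \<open>y'\<close> above \<open>y\<close> has the lower cover \<open>y k\<close> below its
    coordinate \<open>k\<close>.\<close>
  proof (rule P.foldr_deriv_moebius[OF moebius _ js(2) _ _ y _ y])
    show "set js \<subseteq> carrier (product_order n L)"
      using js Mc by simp
    show "y \<sqsubseteq>\<^bsub>product_order n L\<^esub> y"
      using y by simp
    show "i = j" if "i \<in> set js" "j \<in> set js" "i \<sqsubseteq>\<^bsub>product_order n L\<^esub> j" for i j
      using product_min_decomposition(3)[OF K dist x bot] that unfolding js by blast
    fix i assume "i \<in> set js"
    then obtain k a where k: "k \<in> K" "k \<in> {1..n}" "a \<in> join_irreducibles (L k)"
      "covers (L k) a (y k)" and i: "i = emb k a"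
      using elem js(1) by blast
    interpret Lk: fin_lattice "L k"
      using k(2) by (rule fin_lattice)
    have a: "a \<in> carrier (L k)"
      using k by (simp add: join_irreducibles_def)
    show "join_prime (product_order n L) i"
      using emb_join_prime[OF k(2) Lk.distributive_join_irreducible_prime[OF dist[OF k(1)] k(3)]] i
      by simp
    show "\<not> i \<sqsubseteq>\<^bsub>product_order n L\<^esub> y"
    proof
      assume "i \<sqsubseteq>\<^bsub>product_order n L\<^esub> y"
      then have "a \<sqsubseteq>\<^bsub>L k\<^esub> y k"
        using i emb_le_iff[OF k(2) y] by simp
      then show False
        using k(4) Lk.le_antisym[of a "y k"] by (auto simp: covers_def Lk.lless_eq)
    qed
    fix y' z
    assume y': "y' \<in> carrier (product_order n L)" and z: "z \<in> carrier (product_order n L)"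
      and le: "y \<sqsubseteq>\<^bsub>product_order n L\<^esub> y'" "z \<sqsubseteq>\<^bsub>product_order n L\<^esub> y' \<squnion>\<^bsub>product_order n L\<^esub> i"
        "\<not> i \<sqsubseteq>\<^bsub>product_order n L\<^esub> z"
    show "z \<sqsubseteq>\<^bsub>product_order n L\<^esub> y'"
      unfolding product_le_iff
    proof
      fix l assume l: "l \<in> {1..n}"
      have zl: "z l \<sqsubseteq>\<^bsub>L l\<^esub> y' l \<squnion>\<^bsub>L l\<^esub> emb k a l"
        using le(2) l unfolding i product_le_iff product_join[OF y' emb_closed[OF a] l, symmetric]
        by blast
      show "z l \<sqsubseteq>\<^bsub>L l\<^esub> y' l"
      proof (cases "l = k")
        case True
        have "z k \<sqsubseteq>\<^bsub>L k\<^esub> y' k"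
        proof (rule Lk.distributive_below_join_cover[OF dist[OF k(1)] k(3,4)])
          show "y k \<sqsubseteq>\<^bsub>L k\<^esub> y' k"
            using le(1) k(2) by (simp add: product_le_iff)
          show "z k \<sqsubseteq>\<^bsub>L k\<^esub> y' k \<squnion>\<^bsub>L k\<^esub> a"
            using zl True k(2) by (simp add: emb_apply)
          show "\<not> a \<sqsubseteq>\<^bsub>L k\<^esub> z k"
            using le(3) i emb_le_iff[OF k(2) z] by simp
        qed (use product_closed y' z k(2) in auto)
        then show ?thesis
          using True by simp
      next
        case False
        then show ?thesis
          using zl l component_join_bottom(1)[OF l product_closed[OF y' l]] by (simp add: emb_apply)
      qed
    qed
  qed
  also have "{z \<in> carrier (product_order n L).
      z \<sqsubseteq>\<^bsub>product_order n L\<^esub> y \<squnion>\<^bsub>product_order n L\<^esub> \<Squnion>\<^bsub>product_order n L\<^esub>(set js) \<and>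
      (\<forall>i\<in>set js. i \<sqsubseteq>\<^bsub>product_order n L\<^esub> z)} = \<lbrace>x..y \<squnion>\<^bsub>product_order n L\<^esub> x\<rbrace>\<^bsub>product_order n L\<^esub>"
  proof -
    \<comment> \<open>Lying above every element of the decomposition amounts to lying above its join
      \<open>x\<close>, which turns the range of summation into an interval.\<close>
    have "(\<forall>i\<in>?M. i \<sqsubseteq>\<^bsub>product_order n L\<^esub> z) \<longleftrightarrow> x \<sqsubseteq>\<^bsub>product_order n L\<^esub> z"
      if z: "z \<in> carrier (product_order n L)" for z
    proof
      show "x \<sqsubseteq>\<^bsub>product_order n L\<^esub> z" if "\<forall>i\<in>?M. i \<sqsubseteq>\<^bsub>product_order n L\<^esub> z"
        using P.Sup_le[OF Mc z] that eta(2) by simp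
      show "\<forall>i\<in>?M. i \<sqsubseteq>\<^bsub>product_order n L\<^esub> z" if xz: "x \<sqsubseteq>\<^bsub>product_order n L\<^esub> z"
      proof
        fix i assume i: "i \<in> ?M"
        then have "i \<sqsubseteq>\<^bsub>product_order n L\<^esub> x"
          using P.Sup_upper[OF Mc i] eta(2) by simp
        then show "i \<sqsubseteq>\<^bsub>product_order n L\<^esub> z"
          using P.le_trans[of i x z] xz x z i Mc by auto
      qed
    qed
    then show ?thesis
      using eta(2) by (auto simp: js(1) at_least_at_most_def)
  qed
  finally show ?thesis .
qed

section \<open>Common lower covers in a coordinate\<close>

lemma common_lower_cover_props:
  assumes k: "k \<in> {1..n}" and ne: "\<bottom>\<^bsub>L k\<^esub> \<noteq> \<top>\<^bsub>L k\<^esub>" and dist: "distributive_lattice (L k)"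
    and a: "a \<in> carrier (L k)" and ex: "\<exists>!j. is_common_lower_cover (L k) a j"
  defines "j \<equiv> common_lower_cover (L k) a"
  shows "j \<in> carrier (L k)" "\<And>i. i \<in> \<eta>\<^sup>*\<^bsub>L k\<^esub> a \<Longrightarrow> covers (L k) i j"
    "j \<noteq> \<top>\<^bsub>L k\<^esub>" "j \<squnion>\<^bsub>L k\<^esub> a = a" "a \<noteq> \<bottom>\<^bsub>L k\<^esub>"
proof -
  interpret Lk: fin_lattice "L k"
    using k by (rule fin_lattice)
  have j: "is_common_lower_cover (L k) a j"
    unfolding j_def common_lower_cover_def using ex by (rule theI')
  then show jc: "j \<in> carrier (L k)" and cov: "\<And>i. i \<in> \<eta>\<^sup>*\<^bsub>L k\<^esub> a \<Longrightarrow> covers (L k) i j"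
    by (auto simp: is_common_lower_cover_def)
  \<comment> \<open>For an empty decomposition every element would vacuously be a common lower
    cover, and uniqueness would fail as bottom and top differ. Any \<open>i\<close> in the
    decomposition then gives \<open>j\<close> strictly below \<open>i\<close> and \<open>i\<close>
    below \<open>a\<close>, from which the remaining claims follow.\<close>
  have "\<eta>\<^sup>*\<^bsub>L k\<^esub> a \<noteq> {}"
  proof
    assume "\<eta>\<^sup>*\<^bsub>L k\<^esub> a = {}"
    then have "is_common_lower_cover (L k) a \<bottom>\<^bsub>L k\<^esub>" "is_common_lower_cover (L k) a \<top>\<^bsub>L k\<^esub>"
      by (auto simp: is_common_lower_cover_def)
    then show False
      using ex ne by blast
  qed
  then obtain i where i: "i \<in> \<eta>\<^sup>*\<^bsub>L k\<^esub> a"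
    by blast
  note eta = Lk.min_decomposition_antichain[OF a Lk.distributive_join_irreducible_prime[OF dist]]
  have ic: "i \<in> carrier (L k)" "i \<noteq> \<bottom>\<^bsub>L k\<^esub>"
    using i eta(1) by (auto simp: join_irreducibles_def)
  have ia: "i \<sqsubseteq>\<^bsub>L k\<^esub> a"
    using Lk.Sup_upper[OF _ i] eta(1,2) Lk.join_irreducibles_closed by auto
  have ji: "j \<sqsubseteq>\<^bsub>L k\<^esub> i" "j \<noteq> i"
    using cov[OF i] by (auto simp: covers_def Lk.lless_eq)
  show "j \<noteq> \<top>\<^bsub>L k\<^esub>"
    using ji ic Lk.top_higher[of i] Lk.le_antisym[of i j] jc by auto
  have "j \<sqsubseteq>\<^bsub>L k\<^esub> a"
    using Lk.le_trans[of j i a] ji ia ic jc a by simp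
  then show "j \<squnion>\<^bsub>L k\<^esub> a = a"
    using Lk.le_iff_meet[OF jc a] by simp
  show "a \<noteq> \<bottom>\<^bsub>L k\<^esub>"
    using ia ic Lk.le_antisym[of i "\<bottom>\<^bsub>L k\<^esub>"] by auto
qed

end

section \<open>The interaction index as a sum over an interval\<close>

theorem theorem3:
  fixes n :: nat and L :: "nat \<Rightarrow> 'a gorder" and K :: "nat set"
    and v m :: "(nat \<Rightarrow> 'a) \<Rightarrow> real" and \<alpha> :: "nat \<Rightarrow> nat \<Rightarrow> real"
    and x :: "nat \<Rightarrow> 'a"
  assumes "\<And>k. k \<in> {1..n} \<Longrightarrow> lower_locally_distributive (L k)"
    and "\<And>k. k \<in> {1..n} \<Longrightarrow> \<bottom>\<^bsub>L k\<^esub> \<noteq> \<top>\<^bsub>L k\<^esub>"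
    and "moebius_transform (product_order n L) v m"
    and "K \<subseteq> {1..n}"
    and "\<And>k. k \<in> K \<Longrightarrow> distributive_lattice (L k)"
    and "x \<in> L_tilde n L K"
  shows "interaction n L K \<alpha> v x =
    (\<Sum>z\<in>\<lbrace>x..x_check n L K x\<rbrace>\<^bsub>product_order n L\<^esub>.
       beta n \<alpha> (card K) (num_nonbot n L z) * m z)"
proof -
  note ne = assms(2) and K = assms(4)
  interpret lattice_family n L
  proof (rule lattice_family.intro)
    show "fin_lattice (L k)" if "k \<in> {1..n}" for k
      using assms(1)[OF that]
      by (simp add: lower_locally_distributive_def finite_lattice_def fin_lattice_def
          fin_lattice_axioms_def)
  qed
  have x: "x \<in> carrier (product_order n L)" and bot: "\<And>k. k \<in> {1..n} - K \<Longrightarrow> x k = \<bottom>\<^bsub>L k\<^esub>"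
    and ex: "\<And>k. k \<in> K \<Longrightarrow> \<exists>!j. is_common_lower_cover (L k) (x k) j"
    using assms(6) by (auto simp: L_tilde_def)
  let ?j = "\<lambda>k. common_lower_cover (L k) (x k)"
  have j: "?j k \<in> carrier (L k)" "\<And>i. i \<in> \<eta>\<^sup>*\<^bsub>L k\<^esub> (x k) \<Longrightarrow> covers (L k) i (?j k)"
    "?j k \<noteq> \<top>\<^bsub>L k\<^esub>" "?j k \<squnion>\<^bsub>L k\<^esub> x k = x k" "x k \<noteq> \<bottom>\<^bsub>L k\<^esub>" if k: "k \<in> K" for k
  proof -
    have kn: "k \<in> {1..n}"
      using k K by blast
    note * = common_lower_cover_props[OF kn ne[OF kn] assms(5)[OF k] product_closed[OF x kn] ex[OF k]]
    show "?j k \<in> carrier (L k)" "\<And>i. i \<in> \<eta>\<^sup>*\<^bsub>L k\<^esub> (x k) \<Longrightarrow> covers (L k) i (?j k)"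
      "?j k \<noteq> \<top>\<^bsub>L k\<^esub>" "?j k \<squnion>\<^bsub>L k\<^esub> x k = x k" "x k \<noteq> \<bottom>\<^bsub>L k\<^esub>"
      using * by blast+
  qed
  let ?Y = "{y \<in> carrier (product_order n L).
            (\<forall>k\<in>{1..n} - K. y k \<in> {\<top>\<^bsub>L k\<^esub>, \<bottom>\<^bsub>L k\<^esub>}) \<and> (\<forall>k\<in>K. y k = ?j k)}"
  define D where "D = {1..n} - K"
  \<comment> \<open>The points \<open>y\<close> of the outer sum are parametrized by the set
    \<open>A\<close> of coordinates outside \<open>K\<close> where they are top. The set
    \<open>B z\<close> collects the coordinates outside \<open>K\<close> in which a given
    \<open>z\<close> needs a top in order to lie below \<open>\<phi> A \<squnion> x\<close>.\<close>
  define \<phi> where "\<phi> A = (\<lambda>k\<in>{1..n}. if k \<in> K then ?j k else if k \<in> A then \<top>\<^bsub>L k\<^esub> else \<bottom>\<^bsub>L k\<^esub>)" for A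
  define B where "B z = {k \<in> D. z k \<noteq> \<bottom>\<^bsub>L k\<^esub>}" for z
  let ?I = "\<lbrace>x..x_check n L K x\<rbrace>\<^bsub>product_order n L\<^esub>"
  have finD: "finite D"
    by (simp add: D_def)
  have \<phi>: "\<phi> A \<in> carrier (product_order n L)" for A
    using j(1) component_bounded(1,2) by (auto simp: \<phi>_def product_carrier_iff)
  have bij: "bij_betw \<phi> (Pow D) ?Y"
  \<comment> \<open>The set \<open>A\<close> can be read off from \<open>\<phi> A\<close> because
    top and bottom differ in each coordinate.\<close>
  proof (rule bij_betwI[where g = "\<lambda>y. {k \<in> D. y k = \<top>\<^bsub>L k\<^esub>}"])
    show "\<phi> \<in> Pow D \<rightarrow> ?Y"
      using \<phi> K by (auto simp: \<phi>_def)
    show "(\<lambda>y. {k \<in> D. y k = \<top>\<^bsub>L k\<^esub>}) \<in> ?Y \<rightarrow> Pow D"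
      by auto
    show "{k \<in> D. \<phi> A k = \<top>\<^bsub>L k\<^esub>} = A" if "A \<in> Pow D" for A
      using that ne by (auto simp: \<phi>_def D_def)
    show "\<phi> {k \<in> D. y k = \<top>\<^bsub>L k\<^esub>} = y" if "y \<in> ?Y" for y
    proof (rule product_eqI[OF \<phi>])
      show "y \<in> carrier (product_order n L)"
        using that by simp
      show "\<phi> {k \<in> D. y k = \<top>\<^bsub>L k\<^esub>} k = y k" if "k \<in> {1..n}" for k
        using that \<open>y \<in> ?Y\<close> by (auto simp: \<phi>_def D_def)
    qed
  qed
  \<comment> \<open>Coordinates in \<open>K\<close> do not count, since a common lower cover is
    never the top.\<close>
  have num_top: "num_top n L (\<phi> A) = card A" if A: "A \<subseteq> D" for A
  proof -
    have "{l \<in> {1..n}. \<phi> A l = \<top>\<^bsub>L l\<^esub>} = A"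
      using A ne j(3) by (auto simp: \<phi>_def D_def)
    then show ?thesis
      by (simp add: num_top_def)
  qed
  \<comment> \<open>In a coordinate of \<open>K\<close> the join with \<open>x\<close> is
    \<open>x k\<close>, whatever \<open>A\<close> is. Outside \<open>K\<close> it is top or bottom,
    and in the latter case \<open>z k\<close> has to be bottom. Hence \<open>A\<close> enters only
    through the inclusion \<open>B z \<subseteq> A\<close>.\<close>
  have interval: "\<lbrace>x..\<phi> A \<squnion>\<^bsub>product_order n L\<^esub> x\<rbrace>\<^bsub>product_order n L\<^esub> = {z \<in> ?I. B z \<subseteq> A}" for A
  proof -
    have "z k \<sqsubseteq>\<^bsub>L k\<^esub> (\<phi> A \<squnion>\<^bsub>product_order n L\<^esub> x) k \<longleftrightarrow>
        z k \<sqsubseteq>\<^bsub>L k\<^esub> x_check n L K x k \<and> (k \<in> B z \<longrightarrow> k \<in> A)"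
      if z: "z \<in> carrier (product_order n L)" and k: "k \<in> {1..n}" for z k
    proof -
      interpret Lk: fin_lattice "L k"
        using k by (rule fin_lattice)
      have zk: "z k \<in> carrier (L k)"
        using product_closed z k by blast
      have join: "(\<phi> A \<squnion>\<^bsub>product_order n L\<^esub> x) k = \<phi> A k \<squnion>\<^bsub>L k\<^esub> x k"
        by (rule product_join[OF \<phi> x k])
      show ?thesis
      proof (cases "k \<in> K")
        case True
        then show ?thesis
          unfolding join using k j(4)[OF True] by (simp add: \<phi>_def x_check_def B_def D_def)
      next
        case False
        then have "(\<phi> A \<squnion>\<^bsub>product_order n L\<^esub> x) k = \<phi> A k"
          unfolding join using bot[of k] k component_join_bottom(1)[OF k product_closed[OF \<phi> k]] by simp
        then have \<phi>_join: "(\<phi> A \<squnion>\<^bsub>product_order n L\<^esub> x) k =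
            (if k \<in> A then \<top>\<^bsub>L k\<^esub> else \<bottom>\<^bsub>L k\<^esub>)"
          using False k by (simp add: \<phi>_def)
        have "z k \<sqsubseteq>\<^bsub>L k\<^esub> \<bottom>\<^bsub>L k\<^esub> \<longleftrightarrow> z k = \<bottom>\<^bsub>L k\<^esub>"
          using zk Lk.le_antisym[of "z k" "\<bottom>\<^bsub>L k\<^esub>"] by auto
        then show ?thesis
          unfolding \<phi>_join using False k zk by (simp add: x_check_def B_def D_def)
      qed
    qed
    moreover have "(\<forall>k\<in>{1..n}. k \<in> B z \<longrightarrow> k \<in> A) \<longleftrightarrow> B z \<subseteq> A" for z
      by (auto simp: B_def D_def)
    ultimately show ?thesis
      by (auto simp: at_least_at_most_def product_le_iff ball_conj_distrib simp del: One_nat_def)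
  qed
  have deriv: "lattice_deriv (product_order n L) x v (\<phi> A) = (\<Sum>z\<in>{z \<in> ?I. B z \<subseteq> A}. m z)" for A
    unfolding interval[symmetric]
  proof (rule lattice_deriv_moebius[OF K assms(5) x bot assms(3) \<phi>])
    show "covers (L k) i (\<phi> A k)" if "k \<in> K" "i \<in> \<eta>\<^sup>*\<^bsub>L k\<^esub> (x k)" for k i
      using j(2)[OF that] that K by (auto simp: \<phi>_def)
  qed
  \<comment> \<open>Since \<open>x k\<close> is not bottom for \<open>k\<close> in \<open>K\<close>,
    neither is \<open>z k\<close>, so \<open>num_nonbot n L z\<close> equals
    \<open>card K + card (B z)\<close>. The truncated subtraction in \<open>beta\<close> is thus
    exact with value \<open>card (B z)\<close>, and \<open>D - B z\<close> has
    \<open>n - num_nonbot n L z\<close> elements, as the binomial coefficient requires.\<close>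
  have beta: "beta n \<alpha> (card K) (num_nonbot n L z) = (\<Sum>A\<in>{A \<in> Pow D. B z \<subseteq> A}. \<alpha> (card K) (card A))"
    if z: "z \<in> ?I" for z
  proof -
    have "z k \<noteq> \<bottom>\<^bsub>L k\<^esub>" if k: "k \<in> K" for k
    proof
      assume zk: "z k = \<bottom>\<^bsub>L k\<^esub>"
      have kn: "k \<in> {1..n}"
        using k K by blast
      interpret Lk: fin_lattice "L k"
        using kn by (rule fin_lattice)
      have "x k \<sqsubseteq>\<^bsub>L k\<^esub> \<bottom>\<^bsub>L k\<^esub>"
        using z kn by (auto simp: at_least_at_most_def product_le_iff simp flip: zk)
      then show False
        using j(5)[OF k] Lk.le_antisym[of "x k" "\<bottom>\<^bsub>L k\<^esub>"] product_closed[OF x kn] by auto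
    qed
    then have "{l \<in> {1..n}. z l \<noteq> \<bottom>\<^bsub>L l\<^esub>} = K \<union> B z"
      using K by (auto simp: B_def D_def)
    moreover have "card (K \<union> B z) = card K + card (B z)"
      using finite_subset[OF K] finD by (intro card_Un_disjoint) (auto simp: B_def D_def)
    ultimately have nb: "num_nonbot n L z = card K + card (B z)"
      by (simp add: num_nonbot_def)
    have "card (D - B z) = card D - card (B z)"
      using finD by (intro card_Diff_subset) (auto simp: B_def)
    also have "card D = n - card K"
      using card_Diff_subset[OF finite_subset[OF K] K] by (simp add: D_def)
    finally have C: "card (D - B z) = n - num_nonbot n L z"
      by (simp add: nb)
    have "{A \<in> Pow D. B z \<subseteq> A} = {A. B z \<subseteq> A \<and> A \<subseteq> B z \<union> (D - B z)}"
      by (auto simp: B_def)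
    then have "(\<Sum>A\<in>{A \<in> Pow D. B z \<subseteq> A}. \<alpha> (card K) (card A)) =
        (\<Sum>A\<in>{A. B z \<subseteq> A \<and> A \<subseteq> B z \<union> (D - B z)}. \<alpha> (card K) (card A))"
      by (rule arg_cong)
    also have "\<dots> = (\<Sum>l=0..card (D - B z). real (card (D - B z) choose l) * \<alpha> (card K) (card (B z) + l))"
      using finD by (intro sum_card_subsets_between) (auto simp: B_def)
    also have "\<dots> = beta n \<alpha> (card K) (num_nonbot n L z)"
      unfolding C beta_def by (simp add: nb)
    finally show ?thesis
      by simp
  qed
  have "interaction n L K \<alpha> v x = (\<Sum>A\<in>Pow D. \<alpha> (card K) (num_top n L (\<phi> A)) *
      lattice_deriv (product_order n L) x v (\<phi> A))"
    unfolding interaction_def by (rule sum.reindex_bij_betw[OF bij, symmetric])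
  also have "\<dots> = (\<Sum>A\<in>Pow D. \<Sum>z\<in>{z \<in> ?I. B z \<subseteq> A}. \<alpha> (card K) (card A) * m z)"
    by (rule sum.cong[OF refl]) (simp add: num_top deriv sum_distrib_left)
  also have "\<dots> = (\<Sum>z\<in>?I. \<Sum>A\<in>{A \<in> Pow D. B z \<subseteq> A}. \<alpha> (card K) (card A) * m z)"
    using finD P.finite_carrier by (intro sum.swap_restrict) (auto simp: at_least_at_most_def)
  also have "\<dots> = (\<Sum>z\<in>?I. beta n \<alpha> (card K) (num_nonbot n L z) * m z)"
    by (rule sum.cong[OF refl]) (simp add: beta sum_distrib_right)
  finally show ?thesis .
qed

end
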